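(* Let $n,m\ge0$ with $n+m>0$. Let $\operatorname{Ch}(\widetilde{\mathcal{L}}_{n,m})$ denote the symmetric function obtained as the limit $N\to\infty$ of the character $\operatorname{ch}(\widetilde{\mathcal{L}}_{n,m};x_1,\dots,x_N)$, where $\widetilde{\mathcal{L}}_{n,m}$ is the bidegree-$(n,m)$ component of the free Lie superalgebra on $V_0\oplus V_1=\mathbb{C}^N\oplus\mathbb{C}^N$ with the diagonal $\mathrm{GL}(\mathbb{C}^N)$-action. Let $C_{n+m}\le S_{n+m}$ be the cyclic subgroup generated by $\pi=(1\,2\,\cdots\,n+m)$, let $\chi^r$ be the character of $C_{n+m}$ with $\chi^r(\pi)=\exp(2\pi i r/(n+m))$, and let $\chi^{\mathrm{cyc}}$ be the character of the permutation action of $C_{n+m}$ on $m$-element subsets of $[n+m]$ in which $\pi$ adds $1$ modulo $n+m$ to each element. Then \[ \operatorname{Ch}(\widetilde{\mathcal{L}}_{n,m})=\begin{cases}\operatorname{Frob}\big((\chi^{\mathrm{cyc}}\otimes\chi^{1})\uparrow_{C_{n+m}}^{S_{n+m}}\big) & m \text{ odd},\\ \operatorname{Frob}\big((\chi^{\mathrm{cyc}}\otimes\chi^{m/2+1})\uparrow_{C_{n+m}}^{S_{n+m}}\big) & m\text{ even},\end{cases} \] where $\operatorname{Frob}$ is the Frobenius characteristic map.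
   Context: Tensor superalgebra $\widetilde{T}(V)=\bigoplus_d (V_0\oplus V_1)^{\otimes d}$, bigraded by numbers $(n,m)$ of factors from $V_0$ and $V_1$; super commutator $[x,y]=xy-(-1)^{|x||y|}yx$ where the parity of an element of bidegree $(n,m)$ is $m \bmod 2$. The free Lie superalgebra $\widetilde{\mathcal{L}}(V)$ is the span of iterated super commutators of elements of $V$, and $\widetilde{\mathcal{L}}_{n,m}$ is its bidegree-$(n,m)$ part. The character of a $\mathrm{GL}(\mathbb{C}^N)$-module is the trace of $\mathrm{diag}(x_1,\dots,x_N)$. The Frobenius characteristic sends the Specht module $S^\lambda$ to the Schur function $s_\lambda$, extended linearly to class functions. *)

theory Defs
  imports Complex_Main "HOL-Library.Function_Algebras" "HOL-Combinatorics.Permutations"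
begin

text \<open>A letter (p, i) is the i-th standard basis vector of V_1 (if p = True, odd)
 or of V_0 (if p = False, even), i < N. A word (list of letters) is a basis
 tensor of the tensor superalgebra; an element of the tensor superalgebra is a
 coefficient function on words (only finitely many words occur in the elements
 considered below).\<close>

type_synonym letter = "bool \<times> nat"
type_synonym tensor = "letter list \<Rightarrow> complex"

definition tscale :: "complex \<Rightarrow> tensor \<Rightarrow> tensor" where
  "tscale c f = (\<lambda>w. c * f w)"

definition tmul :: "tensor \<Rightarrow> tensor \<Rightarrow> tensor" where
  "tmul f g = (\<lambda>w. \<Sum>k\<in>{0..length w}. f (take k w) * g (drop k w))"

definition gen :: "letter \<Rightarrow> tensor" where
  "gen a = (\<lambda>w. if w = [a] then 1 else 0)"

text \<open>Iterated super commutators of basis vectors of V, with their bidegree (n,m):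
 the parity of a bidegree-(n,m) element is m mod 2, and
 [x,y] = xy - (-1)^(|x||y|) yx.\<close>
inductive lie_mono :: "nat \<Rightarrow> tensor \<Rightarrow> nat \<Rightarrow> nat \<Rightarrow> bool" for N where
  even_gen: "i < N \<Longrightarrow> lie_mono N (gen (False, i)) 1 0"
| odd_gen: "i < N \<Longrightarrow> lie_mono N (gen (True, i)) 0 1"
| bracket: "lie_mono N x n m \<Longrightarrow> lie_mono N y n' m' \<Longrightarrow>
     lie_mono N (tmul x y - tscale ((-1) ^ (m * m')) (tmul y x)) (n + n') (m + m')"

definition free_lie_super :: "nat \<Rightarrow> tensor set" where
  "free_lie_super N = module.span tscale {x. \<exists>n m. lie_mono N x n m}"

definition bideg :: "nat \<Rightarrow> nat \<Rightarrow> tensor set" where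
  "bideg n m = {f. \<forall>w. f w \<noteq> 0 \<longrightarrow>
      length (filter (\<lambda>a. \<not> fst a) w) = n \<and> length (filter fst w) = m}"

definition lie_part :: "nat \<Rightarrow> nat \<Rightarrow> nat \<Rightarrow> tensor set" where
  "lie_part N n m = free_lie_super N \<inter> bideg n m"

text \<open>Diagonal action of diag(x_0,...,x_{N-1}) in GL(C^N) (acting diagonally on
 V_0 and V_1, hence on tensors).\<close>
definition diag_act :: "(nat \<Rightarrow> complex) \<Rightarrow> tensor \<Rightarrow> tensor" where
  "diag_act x f = (\<lambda>w. prod_list (map (\<lambda>a. x (snd a)) w) * f w)"

definition trace_on :: "tensor set \<Rightarrow> (tensor \<Rightarrow> tensor) \<Rightarrow> complex" where
  "trace_on W T = (let B = (SOME B. finite B \<and> \<not> module.dependent tscale B \<and>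
                                    module.span tscale B = W)
                   in \<Sum>b\<in>B. module.representation tscale B (T b) b)"

definition lie_char :: "nat \<Rightarrow> nat \<Rightarrow> nat \<Rightarrow> (nat \<Rightarrow> complex) \<Rightarrow> complex" where
  "lie_char N n m x = trace_on (lie_part N n m) (diag_act x)"

text \<open>S_d is realised as the permutations of {0..<d}; the long cycle
 pi = (1 2 ... d) becomes i |-> i+1 mod d.\<close>

definition rot :: "nat \<Rightarrow> nat \<Rightarrow> nat" where
  "rot d i = (if i < d then (i + 1) mod d else i)"

definition cyc_group :: "nat \<Rightarrow> (nat \<Rightarrow> nat) set" where
  "cyc_group d = {rot d ^^ k | k. k < d}"

definition cyc_exp :: "nat \<Rightarrow> (nat \<Rightarrow> nat) \<Rightarrow> nat" where
  "cyc_exp d c = (THE k. k < d \<and> c = rot d ^^ k)"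

definition chi_lin :: "nat \<Rightarrow> nat \<Rightarrow> (nat \<Rightarrow> nat) \<Rightarrow> complex" where
  "chi_lin d r c = exp (2 * pi * \<i> * of_nat r * of_nat (cyc_exp d c) / of_nat d)"

definition chi_cyc :: "nat \<Rightarrow> nat \<Rightarrow> (nat \<Rightarrow> nat) \<Rightarrow> complex" where
  "chi_cyc d m c = of_nat (card {A. A \<subseteq> {0..<d} \<and> card A = m \<and> c ` A = A})"

definition induce_cyc :: "nat \<Rightarrow> ((nat \<Rightarrow> nat) \<Rightarrow> complex) \<Rightarrow> (nat \<Rightarrow> nat) \<Rightarrow> complex" where
  "induce_cyc d psi g = (1 / of_nat (card (cyc_group d))) *
     (\<Sum>t\<in>{t. t permutes {0..<d} \<and> t \<circ> g \<circ> inv t \<in> cyc_group d}. psi (t \<circ> g \<circ> inv t))"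

definition cycles_of :: "nat \<Rightarrow> (nat \<Rightarrow> nat) \<Rightarrow> nat set set" where
  "cycles_of d s = (\<lambda>i. {(s ^^ k) i | k. True}) ` {0..<d}"

definition psum :: "nat \<Rightarrow> (nat \<Rightarrow> complex) \<Rightarrow> nat \<Rightarrow> complex" where
  "psum N x k = (\<Sum>i<N. x i ^ k)"

text \<open>Frobenius characteristic of a class function f on S_d, evaluated at
 (x_0,...,x_{N-1},0,0,...):  ch(f) = 1/d! sum_s f(s) p_{cycle type of s}.\<close>
definition frob :: "nat \<Rightarrow> ((nat \<Rightarrow> nat) \<Rightarrow> complex) \<Rightarrow> nat \<Rightarrow> (nat \<Rightarrow> complex) \<Rightarrow> complex" where
  "frob d f N x = (1 / of_nat (fact d)) *
     (\<Sum>s\<in>{s. s permutes {0..<d}}. f s * (\<Prod>c\<in>cycles_of d s. psum N x (card c)))"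

end

theory Submission
  imports Defs "HOL-Computational_Algebra.Polynomial" "HOL-Library.FuncSet"
begin

text \<open>
  An element of the tensor superalgebra is a Lie element iff, viewed as a function on words, it
  vanishes on all super shuffles of two nonempty words.  Necessity holds because a super commutator
  of two such functions is again one; sufficiency holds because the Dynkin operator
  (iterated left-normed bracketing) multiplies such a function on words of length \<open>d\<close> by \<open>d\<close>.

  Let \<open>q\<close> be a primitive \<open>d\<close>-th root of unity.  Klyachko's operator
  \<open>(1/d) \<Sum>\<^sub>s q\<^bsup>maj(s\<^sup>-\<^sup>1)\<^esup> s\<close>, with \<open>S\<^sub>d\<close> acting on words by signed place permutations, is a
  projection onto the Lie elements.  It fixes a function vanishing on shuffles: in the expansion of
  each factor of \<open>q\<^bsup>maj\<^esup>\<close> as a constant plus a multiple of the indicator of an ascent, every term but that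
  of the identity sums over shuffles, and the identity has coefficient
  \<open>\<Prod>\<^sub>i (1 - q\<^sup>i) = d\<close>.  Its image
  vanishes on shuffles by Stanley's shuffle theorem, as the \<open>q\<close>-binomial coefficients
  \<open>[d, k]\<close> with \<open>0 < k < d\<close> vanish.  So the character of the Lie elements is the trace of this operator,
  and on class functions it agrees with \<open>(1/d) \<Sum>\<^sub>k q\<^sup>k \<pi>\<^sup>k\<close>.  The trace of \<open>\<pi>\<^sup>k\<close>
  counts fixed words with a sign.  For odd \<open>m\<close> this sign is trivial, and for even \<open>m\<close> it
  is \<open>(-1)\<^sup>a\<close>, where \<open>a\<close> is the number of odd letters among the first \<open>k\<close>; since the word is
  \<open>k\<close>-periodic modulo \<open>d\<close>, \<open>a d = k m\<close>, and the sign is \<open>q\<^bsup>(m/2) k\<^esup>\<close>.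
\<close>

section \<open>Super shuffles and primitive tensors\<close>

definition odd_len :: "letter list \<Rightarrow> nat" where
  "odd_len w = length (filter fst w)"

lemma odd_len_simps [simp]:
  "odd_len [] = 0" "odd_len (u @ v) = odd_len u + odd_len v" "odd_len (rev u) = odd_len u"
  by (simp_all add: odd_len_def flip: rev_filter)

lemma odd_len_Cons: "odd_len (a # u) = odd_len [a] + odd_len u"
  by (simp add: odd_len_def)

lemma odd_len_take_drop: "odd_len (take i u) + odd_len (drop i u) = odd_len u"
  by (metis append_take_drop_id odd_len_simps(2))

text \<open>The value of \<open>f\<close>, extended linearly, at the signed shuffle product of
  \<open>u\<close> and \<open>v\<close>; equivalently, the coefficient of \<open>u\<close> tensor
  \<open>v\<close> in the coproduct of \<open>f\<close> for which all letters are primitive. Pulling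
  \<open>b\<close> in front of \<open>a # u\<close> costs the Koszul sign.\<close>

fun super_shuffle :: "tensor \<Rightarrow> letter list \<Rightarrow> letter list \<Rightarrow> complex" where
  "super_shuffle f [] v = f v"
| "super_shuffle f (a # u) [] = f (a # u)"
| "super_shuffle f (a # u) (b # v) = super_shuffle (\<lambda>z. f (a # z)) u (b # v)
     + (-1) ^ (odd_len [b] * odd_len (a # u)) * super_shuffle (\<lambda>z. f (b # z)) (a # u) v"

lemma super_shuffle_Nil2 [simp]: "super_shuffle f u [] = f u"
  by (cases u) auto

lemma super_shuffle_add:
  "super_shuffle (\<lambda>z. f z + g z) u v = super_shuffle f u v + super_shuffle g u v"
proof (induction f u v arbitrary: g rule: super_shuffle.induct)
  case (3 f a u b v)
  show ?case
    unfolding super_shuffle.simps "3.IH" by (simp add: distrib_left)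
qed simp_all

lemma super_shuffle_scale: "super_shuffle (\<lambda>z. c * f z) u v = c * super_shuffle f u v"
  by (induction f u v rule: super_shuffle.induct) (simp_all add: algebra_simps)

lemma super_shuffle_diff:
  "super_shuffle (\<lambda>z. f z - g z) u v = super_shuffle f u v - super_shuffle g u v"
  using super_shuffle_add[of f "\<lambda>z. (-1) * g z" u v] super_shuffle_scale[of "-1" g u v] by simp

lemma super_shuffle_cong:
  "(\<And>z. length z = length u + length v \<Longrightarrow> f z = g z) \<Longrightarrow> super_shuffle f u v = super_shuffle g u v"
proof (induction f u v arbitrary: g rule: super_shuffle.induct)
  case (3 f a u b v)
  show ?case
    using "3.IH"(1)[of "\<lambda>z. g (a # z)"] "3.IH"(2)[of "\<lambda>z. g (b # z)"] "3.prems" by simp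
qed auto

lemma tmul_Cons: "tmul f g (a # w) = f [] * g (a # w) + tmul (\<lambda>z. f (a # z)) g w"
  unfolding tmul_def
  by (simp add: atLeast0AtMost sum.atMost_Suc_shift del: sum.atMost_Suc)

text \<open>Cutting a shuffle of \<open>u\<close> and \<open>v\<close> in two gives a shuffle of two
  prefixes and a shuffle of the complementary suffixes; the sign arises because the letters of
  \<open>take j v\<close> have passed those of \<open>drop i u\<close>. Dually, the coproduct is
  multiplicative.\<close>

lemma super_shuffle_tmul:
  "super_shuffle (tmul f g) u v =
    (\<Sum>i\<le>length u. \<Sum>j\<le>length v. (-1) ^ (odd_len (drop i u) * odd_len (take j v))
       * super_shuffle f (take i u) (take j v) * super_shuffle g (drop i u) (drop j v))"
proof (induction f u v rule: super_shuffle.induct)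
  case (1 f v)
  then show ?case by (simp add: tmul_def atLeast0AtMost)
next
  case (2 f a u)
  then show ?case by (simp add: tmul_def atLeast0AtMost)
next
  case (3 f a u b v)
  define s where "s = ((-1) ^ (odd_len [b] * odd_len (a # u)) :: complex)"
  define fa where "fa = (\<lambda>z. f (a # z))"
  define fb where "fb = (\<lambda>z. f (b # z))"
  have ca: "(\<lambda>z. tmul f g (a # z)) = (\<lambda>z. f [] * g (a # z) + tmul fa g z)"
    and cb: "(\<lambda>z. tmul f g (b # z)) = (\<lambda>z. f [] * g (b # z) + tmul fb g z)"
    by (simp_all add: tmul_Cons fa_def fb_def)
  have L: "super_shuffle (tmul f g) (a # u) (b # v) = f [] * super_shuffle g (a # u) (b # v)
      + super_shuffle (tmul fa g) u (b # v) + s * super_shuffle (tmul fb g) (a # u) v"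
    unfolding super_shuffle.simps ca cb super_shuffle_add super_shuffle_scale
    by (simp add: s_def algebra_simps)
  \<comment> \<open>A head \<open>b\<close> has to pass all of \<open>a # u\<close>: the part
    \<open>drop i u\<close> by the cut, the part \<open>a # take i u\<close> within the shuffle of
    the prefixes.\<close>
  have sg: "(-1) ^ (odd_len (drop i u) * odd_len (b # take j v)) * (-1) ^ (odd_len [b] * odd_len (a # take i u))
     = s * (-1) ^ (odd_len (drop i u) * odd_len (take j v))" for i j
  proof -
    have "odd_len (drop i u) * odd_len (b # take j v) + odd_len [b] * odd_len (a # take i u)
       = odd_len [b] * odd_len (a # u) + odd_len (drop i u) * odd_len (take j v)"
      unfolding odd_len_Cons[of b "take j v"] odd_len_Cons[of a u] odd_len_Cons[of a "take i u"]
        odd_len_take_drop[of i u, symmetric]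
      by (simp only: distrib_left distrib_right ac_simps)
    then show ?thesis unfolding s_def by (metis power_add)
  qed
  have s0: "(-1) ^ (odd_len (a # u) * odd_len (b # take j v)) = s * (-1) ^ (odd_len (a # u) * odd_len (take j v))" for j
    unfolding s_def by (subst odd_len_Cons[of b]) (simp add: distrib_left power_add mult.commute)
  let ?G = "\<lambda>i j. super_shuffle g (drop i u) (drop j v)"
  have A: "super_shuffle (tmul fa g) u (b # v) = (\<Sum>i\<le>length u. f (a # take i u) * super_shuffle g (drop i u) (b # v)
      + (\<Sum>j\<le>length v. (-1) ^ (odd_len (drop i u) * odd_len (b # take j v))
       * super_shuffle fa (take i u) (b # take j v) * ?G i j))"
    using "3.IH"(1) unfolding fa_def
    by (simp add: sum.atMost_Suc_shift del: sum.atMost_Suc)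
  have B: "super_shuffle (tmul fb g) (a # u) v = (\<Sum>j\<le>length v. (-1) ^ (odd_len (a # u) * odd_len (take j v))
       * f (b # take j v) * super_shuffle g (a # u) (drop j v)) +
      (\<Sum>i\<le>length u. \<Sum>j\<le>length v. (-1) ^ (odd_len (drop i u) * odd_len (take j v))
       * super_shuffle fb (a # take i u) (take j v) * ?G i j)"
    using "3.IH"(2) unfolding fb_def
    by (simp add: sum.atMost_Suc_shift del: sum.atMost_Suc)
  have T: "(-1) ^ (odd_len (drop i u) * odd_len (b # take j v))
       * super_shuffle f (a # take i u) (b # take j v) * ?G i j =
     (-1) ^ (odd_len (drop i u) * odd_len (b # take j v)) * super_shuffle fa (take i u) (b # take j v) * ?G i j
     + s * ((-1) ^ (odd_len (drop i u) * odd_len (take j v)) * super_shuffle fb (a # take i u) (take j v) * ?G i j)" for i j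
  proof -
    have "(-1) ^ (odd_len (drop i u) * odd_len (b # take j v)) * super_shuffle f (a # take i u) (b # take j v) =
       (-1) ^ (odd_len (drop i u) * odd_len (b # take j v)) * super_shuffle fa (take i u) (b # take j v)
       + ((-1) ^ (odd_len (drop i u) * odd_len (b # take j v)) * (-1) ^ (odd_len [b] * odd_len (a # take i u))) *
         super_shuffle fb (a # take i u) (take j v)"
      by (simp add: fa_def fb_def distrib_left)
    then show ?thesis unfolding sg by (simp add: algebra_simps)
  qed
  have "(\<Sum>i\<le>length (a#u). \<Sum>j\<le>length (b#v). (-1) ^ (odd_len (drop i (a#u)) * odd_len (take j (b#v)))
       * super_shuffle f (take i (a#u)) (take j (b#v)) * super_shuffle g (drop i (a#u)) (drop j (b#v)))
    = f [] * super_shuffle g (a # u) (b # v)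
      + (\<Sum>j\<le>length v. (-1) ^ (odd_len (a # u) * odd_len (b # take j v)) * f (b # take j v) * super_shuffle g (a # u) (drop j v))
      + (\<Sum>i\<le>length u. f (a # take i u) * super_shuffle g (drop i u) (b # v)
      + (\<Sum>j\<le>length v. (-1) ^ (odd_len (drop i u) * odd_len (b # take j v))
       * super_shuffle f (a # take i u) (b # take j v) * ?G i j))"
    by (simp add: sum.atMost_Suc_shift del: sum.atMost_Suc super_shuffle.simps(3))
  also have "\<dots> = f [] * super_shuffle g (a # u) (b # v)
      + super_shuffle (tmul fa g) u (b # v) + s * super_shuffle (tmul fb g) (a # u) v"
    unfolding A B T s0 by (simp add: sum.distrib sum_distrib_left distrib_left mult.assoc)
  finally show ?case using L by simp
qed

text \<open>Primitivity for the coproduct dual to the super shuffle product; Friedrichs' criterion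
  characterises Lie elements by it.\<close>

definition primitive :: "tensor \<Rightarrow> bool" where
  "primitive f \<longleftrightarrow> f [] = 0 \<and> (\<forall>u v. u \<noteq> [] \<longrightarrow> v \<noteq> [] \<longrightarrow> super_shuffle f u v = 0)"

lemma super_shuffle_primitive:
  "primitive f \<Longrightarrow> super_shuffle f u v = (if u = [] then f v else if v = [] then f u else 0)"
  by (auto simp: primitive_def)

text \<open>In the double sum over cuts only two survive: \<open>u\<close> wholly in the first
  factor and \<open>v\<close> in the second, or the reverse.\<close>

lemma super_shuffle_tmul_primitive:
  assumes "primitive f" "primitive g" "u \<noteq> []" "v \<noteq> []"
  shows "super_shuffle (tmul f g) u v = f u * g v + (-1) ^ (odd_len u * odd_len v) * f v * g u"
proof -
  let ?t = "\<lambda>i j. (-1) ^ (odd_len (drop i u) * odd_len (take j v))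
       * super_shuffle f (take i u) (take j v) * super_shuffle g (drop i u) (drop j v)"
  have z: "?t i j = (if i = length u then if j = 0 then f u * g v else 0 else 0) +
     (if i = 0 then if j = length v then (-1) ^ (odd_len u * odd_len v) * f v * g u else 0 else 0)"
    if "i \<le> length u" "j \<le> length v" for i j
  proof -
    have e: "take i u = [] \<longleftrightarrow> i = 0" "take j v = [] \<longleftrightarrow> j = 0"
      "drop i u = [] \<longleftrightarrow> i = length u" "drop j v = [] \<longleftrightarrow> j = length v"
      using that assms(3,4) le_antisym[of i "length u"] le_antisym[of j "length v"]
      by (simp_all only: take_eq_Nil drop_eq_Nil) fast+
    have a: "f [] = 0" "g [] = 0" "length u \<noteq> 0" "length v \<noteq> 0"
      using assms by (simp_all add: primitive_def)
    show ?thesis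
      unfolding super_shuffle_primitive[OF assms(1)] super_shuffle_primitive[OF assms(2)] e
      using a by (cases "i = 0"; cases "j = 0"; cases "i = length u"; cases "j = length v") simp_all
  qed
  have "super_shuffle (tmul f g) u v = (\<Sum>i\<le>length u. \<Sum>j\<le>length v. ?t i j)"
    by (rule super_shuffle_tmul)
  also have "\<dots> = (\<Sum>i\<le>length u. \<Sum>j\<le>length v. (if i = length u then if j = 0 then f u * g v else 0 else 0) +
     (if i = 0 then if j = length v then (-1) ^ (odd_len u * odd_len v) * f v * g u else 0 else 0))"
    by (intro sum.cong refl z) auto
  also have "\<dots> = f u * g v + (-1) ^ (odd_len u * odd_len v) * f v * g u"
  proof -
    have d: "(\<Sum>i\<le>length u. \<Sum>j\<le>length v. if i = p then if j = q then c else 0 else 0) = c"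
      if "p \<le> length u" "q \<le> length v" for p q and c :: complex
    proof -
      have "(\<Sum>j\<le>length v. if i = p then if j = q then c else 0 else 0) = (if i = p then c else 0)" for i
        using that(2) by (cases "i = p") simp_all
      then show ?thesis using that(1) by simp
    qed
    show ?thesis unfolding sum.distrib by (simp only: d order_refl le0)
  qed
  finally show ?thesis .
qed

lemma bideg_odd_len: "f \<in> bideg n m \<Longrightarrow> f w \<noteq> 0 \<Longrightarrow> odd_len w = m"
  by (auto simp: bideg_def odd_len_def)

text \<open>Homogeneity fixes the signs: wherever a product of values of \<open>f\<close> and
  \<open>g\<close> at \<open>u\<close> and \<open>v\<close> is nonzero, the odd letter counts of
  \<open>u\<close> and \<open>v\<close> are \<open>m\<close> and \<open>m'\<close> in some order.
  The shuffle sign then equals the sign of the bracket, and the terms cancel in pairs.\<close>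

lemma primitive_bracket:
  assumes f: "primitive f" "f \<in> bideg n m" and g: "primitive g" "g \<in> bideg n' m'"
  shows "primitive (tmul f g - tscale ((-1) ^ (m * m')) (tmul g f))"
  unfolding primitive_def
proof (intro conjI allI impI)
  show "(tmul f g - tscale ((-1) ^ (m * m')) (tmul g f)) [] = 0"
    using f g by (simp add: tmul_def tscale_def primitive_def)
next
  fix u v :: "letter list" assume uv: "u \<noteq> []" "v \<noteq> []"
  have e: "tmul f g - tscale ((-1) ^ (m * m')) (tmul g f) = (\<lambda>w. tmul f g w - (-1) ^ (m * m') * tmul g f w)"
    by (auto simp: tscale_def)
  have 1: "f u * g v = 0 \<or> odd_len u = m \<and> odd_len v = m'"
   and 2: "f v * g u = 0 \<or> odd_len v = m \<and> odd_len u = m'"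
    using f g bideg_odd_len by fastforce+
  let ?e = "(-1) ^ (odd_len u * odd_len v) :: complex" and ?E = "(-1) ^ (m * m') :: complex"
  have "?E * ?E = 1" by (simp flip: power_mult_distrib)
  then have "?E * (?E * c) = c" for c by (metis mult.assoc mult_1)
  with 1 have 3: "?E * (?e * (g v * f u)) = g v * f u"
    by (cases "g v * f u = 0") auto
  from 2 have 4: "?E * (g u * f v) = ?e * (g u * f v)"
    by (cases "g u * f v = 0") (auto simp: mult.commute[of m m'])
  show "super_shuffle (tmul f g - tscale ((-1) ^ (m * m')) (tmul g f)) u v = 0"
    unfolding e super_shuffle_diff super_shuffle_scale
      super_shuffle_tmul_primitive[OF f(1) g(1) uv] super_shuffle_tmul_primitive[OF g(1) f(1) uv]
      distrib_left mult.assoc 3 4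
    by (simp add: mult.commute[of "f u"] mult.commute[of "f v"])
qed

section \<open>Lie elements are primitive\<close>

definition letters_below :: "nat \<Rightarrow> tensor set" where
  "letters_below N = {f. \<forall>w. f w \<noteq> 0 \<longrightarrow> (\<forall>a\<in>set w. snd a < N)}"

lemma tmul_nonzeroE:
  assumes "tmul f g w \<noteq> 0"
  obtains u v where "w = u @ v" "f u \<noteq> 0" "g v \<noteq> 0"
proof -
  obtain k where "f (take k w) * g (drop k w) \<noteq> 0"
    using assms unfolding tmul_def by (meson sum.neutral)
  then show ?thesis using that[of "take k w" "drop k w"] by simp
qed

lemma tmul_bideg: "f \<in> bideg n m \<Longrightarrow> g \<in> bideg n' m' \<Longrightarrow> tmul f g \<in> bideg (n + n') (m + m')"
  unfolding bideg_def by (auto elim!: tmul_nonzeroE)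

lemma tmul_letters_below: "f \<in> letters_below N \<Longrightarrow> g \<in> letters_below N \<Longrightarrow> tmul f g \<in> letters_below N"
  unfolding letters_below_def by (fastforce elim!: tmul_nonzeroE)

lemma super_shuffle_zero [simp]: "super_shuffle (\<lambda>_. 0) u v = 0"
  using super_shuffle_scale[of 0 "\<lambda>_. 0" u v] by simp

lemma primitive_gen: "primitive (gen a)"
proof -
  have "super_shuffle (gen a) u v = 0" if "u \<noteq> []" "v \<noteq> []" for u v
  proof -
    have "super_shuffle (gen a) u v = super_shuffle (\<lambda>_. 0) u v"
      using that by (intro super_shuffle_cong) (cases u; cases v; auto simp: gen_def)
    then show ?thesis by simp
  qed
  then show ?thesis by (simp add: primitive_def gen_def)
qed

lemma lie_mono_props:
  assumes "lie_mono N x n m"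
  shows "primitive x \<and> x \<in> bideg n m \<and> x \<in> letters_below N"
  using assms
proof induction
  case (even_gen i)
  then show ?case using even_gen by (simp add: primitive_gen) (auto simp: bideg_def letters_below_def gen_def split: if_splits)
next
  case (odd_gen i)
  then show ?case using odd_gen by (simp add: primitive_gen) (auto simp: bideg_def letters_below_def gen_def split: if_splits)
next
  case (bracket x n m y n' m')
  let ?z = "tmul x y - tscale ((-1) ^ (m * m')) (tmul y x)"
  have nz: "tmul x y w \<noteq> 0 \<or> tmul y x w \<noteq> 0" if "?z w \<noteq> 0" for w
    using that by (auto simp: tscale_def)
  have "tmul y x \<in> bideg (n + n') (m + m')" using bracket tmul_bideg[of y n' m' x n m] by (simp add: add.commute)
  moreover have "tmul x y \<in> bideg (n + n') (m + m')" using bracket tmul_bideg by blast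
  ultimately have "?z \<in> bideg (n + n') (m + m')" using nz unfolding bideg_def mem_Collect_eq by blast
  moreover have "tmul x y \<in> letters_below N" "tmul y x \<in> letters_below N" using bracket tmul_letters_below by blast+
  then have "?z \<in> letters_below N" using nz unfolding letters_below_def mem_Collect_eq by blast
  ultimately show ?case using primitive_bracket bracket by blast
qed

global_interpretation tens: vector_space tscale
  by unfold_locales (auto simp: tscale_def algebra_simps)

lemma free_lie_super_props:
  assumes "f \<in> free_lie_super N"
  shows "primitive f" "f \<in> letters_below N"
proof -
  have "primitive f \<and> f \<in> letters_below N"
    using assms unfolding free_lie_super_def
  proof (induction rule: tens.span_induct_alt)
    case base
    show ?case by (auto simp: primitive_def letters_below_def zero_fun_def)
  next
    case (step c x y)
    then have "primitive x" "x \<in> letters_below N" using lie_mono_props by auto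
    then have "primitive (tscale c x + y)"
      using step by (auto simp: primitive_def tscale_def plus_fun_def super_shuffle_add super_shuffle_scale)
    moreover have "tscale c x + y \<in> letters_below N"
      unfolding letters_below_def mem_Collect_eq
    proof (intro allI impI)
      fix w assume "(tscale c x + y) w \<noteq> 0"
      then have "x w \<noteq> 0 \<or> y w \<noteq> 0" by (auto simp: tscale_def)
      then show "\<forall>a\<in>set w. snd a < N"
        using \<open>x \<in> letters_below N\<close> step unfolding letters_below_def by blast
    qed
    ultimately show ?case ..
  qed
  then show "primitive f" "f \<in> letters_below N" by auto
qed

section \<open>The Dynkin operator\<close>

lemma odd_len_Cons_if: "odd_len (a # u) = of_bool (fst a) + odd_len u"
  by (simp add: odd_len_def)

text \<open>The recursion read off the last letters; the Dynkin operator needs it because bracketing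
  attaches letters at both ends of a word.\<close>

lemma super_shuffle_snoc:
  "super_shuffle f (u @ [a]) (v @ [b]) = super_shuffle (\<lambda>z. f (z @ [b])) (u @ [a]) v
     + (-1) ^ (odd_len [a] * odd_len (v @ [b])) * super_shuffle (\<lambda>z. f (z @ [a])) u (v @ [b])"
proof (induction f u v rule: super_shuffle.induct)
  case (1 f v)
  show ?case
  proof (induction v arbitrary: f)
    case (Cons c v)
    show ?case using Cons.IH[of "\<lambda>z. f (c # z)"]
      by (simp add: odd_len_Cons_if power_add algebra_simps)
  qed (simp add: odd_len_Cons_if mult.commute)
next
  case (2 f c u)
  show ?case
  proof (induction u arbitrary: f c)
    case (Cons c' u)
    show ?case using Cons.IH[of "\<lambda>z. f (c # z)" c']
      by (simp add: odd_len_Cons_if power_add algebra_simps)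
  qed (simp add: odd_len_Cons_if power_add algebra_simps)
next
  case (3 f c u e v)
  show ?case using "3.IH"
    by (simp add: odd_len_Cons_if power_add algebra_simps)
qed

text \<open>The bracketing in coefficients: the letter bracketed last stands at the right end of
  \<open>v\<close>, or at its left end with the sign of the super commutator.\<close>

function dynkin :: "tensor \<Rightarrow> letter list \<Rightarrow> complex" where
  "dynkin f v = (if v = [] then 0 else if tl v = [] then f v else
     dynkin (\<lambda>z. f (z @ [last v])) (butlast v)
      - (-1) ^ (odd_len [hd v] * odd_len (tl v)) * dynkin (\<lambda>z. f (z @ [hd v])) (tl v))"
  by auto
termination by (relation "measure (length \<circ> snd)") (auto simp: neq_Nil_conv)

declare dynkin.simps [simp del]

lemma dynkin_Nil [simp]: "dynkin f [] = 0" and dynkin_single [simp]: "dynkin f [a] = f [a]"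
  by (subst dynkin.simps, simp)+

lemma dynkin_Cons_snoc [simp]: "dynkin f (h # m @ [l]) = dynkin (\<lambda>z. f (z @ [l])) (h # m)
      - (-1) ^ (odd_len [h] * odd_len (m @ [l])) * dynkin (\<lambda>z. f (z @ [h])) (m @ [l])"
  by (subst dynkin.simps) simp

lemma word_cases:
  obtains "v = []" | a where "v = [a]" | h m l where "v = h # m @ [l]"
  by (cases v; cases "tl v" rule: rev_cases) auto

lemma dynkin_linear: "dynkin (\<lambda>z. f z + c * g z) v = dynkin f v + c * dynkin g v"
proof (induction "length v" arbitrary: f g v rule: less_induct)
  case less
  show ?case
  proof (cases v rule: word_cases)
    case (3 h m l)
    have "dynkin (\<lambda>z. f (z @ [l]) + c * g (z @ [l])) (h # m) = dynkin (\<lambda>z. f (z @ [l])) (h # m) + c * dynkin (\<lambda>z. g (z @ [l])) (h # m)"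
      by (rule less) (simp add: 3)
    moreover have "dynkin (\<lambda>z. f (z @ [h]) + c * g (z @ [h])) (m @ [l]) = dynkin (\<lambda>z. f (z @ [h])) (m @ [l]) + c * dynkin (\<lambda>z. g (z @ [h])) (m @ [l])"
      by (rule less) (simp add: 3)
    ultimately show ?thesis unfolding 3 dynkin_Cons_snoc by (simp add: algebra_simps)
  qed auto
qed

lemma dynkin_zero [simp]: "dynkin (\<lambda>z. 0) v = 0"
  using dynkin_linear[of "\<lambda>_. 0" 0 "\<lambda>_. 0" v] dynkin_linear[of "\<lambda>_. 0" 1 "\<lambda>_. 0" v] by simp

definition unit_tensor :: "letter list \<Rightarrow> tensor" where
  "unit_tensor w = (\<lambda>z. of_bool (z = w))"

lemma dynkin_sum: "finite W \<Longrightarrow> dynkin (\<lambda>z. \<Sum>w\<in>W. c w * g w z) v = (\<Sum>w\<in>W. c w * dynkin (g w) v)"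
proof (induction W rule: finite_induct)
  case (insert x F)
  then show ?case using dynkin_linear[of "\<lambda>z. \<Sum>w\<in>F. c w * g w z" "c x" "g x" v]
    by (simp add: add.commute)
qed simp

lemma tmul_gen_right: "tmul f (gen c) v = (if v \<noteq> [] \<and> last v = c then f (butlast v) else 0)"
proof (cases v rule: rev_cases)
  case (snoc u l)
  have "tmul f (gen c) v = (\<Sum>k\<in>{0..length v}. if k = length u then of_bool (l = c) * f u else 0)"
    unfolding tmul_def
  proof (intro sum.cong refl)
    fix k assume "k \<in> {0..length v}"
    then consider "k < length u" | "k = length u" | "k = Suc (length u)" using snoc by fastforce
    then show "f (take k v) * gen c (drop k v) = (if k = length u then of_bool (l = c) * f u else 0)"
    proof cases
      case 1
      then have "drop k u \<noteq> []" by simp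
      then have "drop k v \<noteq> [c]" using snoc 1 by auto
      then show ?thesis using 1 by (simp add: gen_def)
    qed (auto simp: snoc gen_def)
  qed
  then show ?thesis using snoc by auto
qed (simp add: tmul_def gen_def)

lemma tmul_gen_left: "tmul (gen c) f v = (if v \<noteq> [] \<and> hd v = c then f (tl v) else 0)"
proof (cases v)
  case (Cons h t)
  have "tmul (gen c) f v = (\<Sum>k\<in>{0..length v}. if k = 1 then of_bool (h = c) * f t else 0)"
    unfolding tmul_def
  proof (intro sum.cong refl)
    fix k assume "k \<in> {0..length v}"
    then show "gen c (take k v) * f (drop k v) = (if k = 1 then of_bool (h = c) * f t else 0)"
      by (cases k; cases "k - 1"; cases t) (auto simp: Cons gen_def)
  qed
  also have "\<dots> = of_bool (h = c) * f t"
    using Cons by (subst sum.delta) auto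
  finally show ?thesis using Cons by simp
qed (simp add: tmul_def gen_def)

text \<open>A basis word is sent to the left-normed bracket of its letters, by induction on the
  letter bracketed last.\<close>

lemma lie_mono_dynkin_unit:
  assumes "w \<noteq> []" "\<forall>a\<in>set w. snd a < N"
  shows "lie_mono N (dynkin (unit_tensor w)) (length w - odd_len w) (odd_len w)"
  using assms
proof (induction w rule: rev_nonempty_induct)
  case (single a)
  have "dynkin (unit_tensor [a]) v = gen a v" for v
  proof (cases v rule: word_cases)
    case (3 h m l)
    have "(\<lambda>z. unit_tensor [a] (z @ [l])) = (\<lambda>z. unit_tensor [] z * of_bool (l = a))"
     "(\<lambda>z. unit_tensor [a] (z @ [h])) = (\<lambda>z. unit_tensor [] z * of_bool (h = a))"
      by (auto simp: unit_tensor_def)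
    have Z: "dynkin (\<lambda>z. unit_tensor [] z * c) v = 0" for v c
    proof (cases v rule: word_cases)
      case (3 h m l)
      then show ?thesis by (simp add: unit_tensor_def)
    qed (simp_all add: unit_tensor_def)
    show ?thesis unfolding 3 dynkin_Cons_snoc
      using Z[of "of_bool (l = a)" "h # m"] Z[of "of_bool (h = a)" "m @ [l]"]
      by (simp add: gen_def unit_tensor_def of_bool_conj)
  qed (auto simp: unit_tensor_def gen_def)
  then have "dynkin (unit_tensor [a]) = gen a" by blast
  then show ?case using single lie_mono.intros(1,2)[of "snd a" N]
    by (cases a; cases "fst a") (auto simp: odd_len_def)
next
  case (snoc c w)
  let ?D = "dynkin (unit_tensor w)"
  have IH: "lie_mono N ?D (length w - odd_len w) (odd_len w)" using snoc by simp
  have g: "lie_mono N (gen c) (1 - odd_len [c]) (odd_len [c])"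
    using snoc.prems lie_mono.intros(1,2)[of "snd c" N] by (cases c; cases "fst c") (auto simp: odd_len_def)
  have le: "odd_len w \<le> length w" for w by (simp add: odd_len_def)
  have bd: "?D u \<noteq> 0 \<Longrightarrow> odd_len u = odd_len w" for u
    using lie_mono_props[OF IH] bideg_odd_len by blast
  have eq: "dynkin (unit_tensor (w @ [c])) v =
     (tmul ?D (gen c) - tscale ((-1) ^ (odd_len w * odd_len [c])) (tmul (gen c) ?D)) v" for v
  proof (cases v rule: word_cases)
    case 1
    then show ?thesis by (simp add: tmul_gen_left tmul_gen_right tscale_def)
  next
    case (2 a)
    then show ?thesis using snoc(1) by (simp add: tmul_gen_left tmul_gen_right tscale_def unit_tensor_def)
  next
    case (3 h m l)
    have e: "(\<lambda>z. unit_tensor (w @ [c]) (z @ [l])) = (\<lambda>z. of_bool (l = c) * unit_tensor w z)" for l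
      by (auto simp: unit_tensor_def)
    have s: "dynkin (\<lambda>z. k * unit_tensor w z) u = k * ?D u" for k u
      using dynkin_linear[of "\<lambda>_. 0" k "unit_tensor w" u] by simp
    \<comment> \<open>The sign in \<open>dynkin\<close> is read off \<open>v\<close>, that of the
      bracket off \<open>w\<close>; they agree because \<open>?D\<close> is supported on words with
      as many odd letters as \<open>w\<close>.\<close>
    have "(-1) ^ (odd_len [h] * odd_len (m @ [l])) * (of_bool (h = c) * ?D (m @ [l])) =
       (-1) ^ (odd_len w * odd_len [c]) * (of_bool (h = c) * ?D (m @ [l]))"
      using bd[of "m @ [l]"] by (cases "?D (m @ [l]) = 0"; cases "h = c") (simp_all add: mult.commute)
    then show ?thesis unfolding 3 dynkin_Cons_snoc e s
      by (auto simp: tmul_gen_left tmul_gen_right tscale_def)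
  qed
  have "length w - odd_len w + (1 - odd_len [c]) = length (w @ [c]) - odd_len (w @ [c])"
    using le[of w] le[of "[c]"] by simp
  moreover have "dynkin (unit_tensor (w @ [c])) =
     tmul ?D (gen c) - tscale ((-1) ^ (odd_len w * odd_len [c])) (tmul (gen c) ?D)"
    by (rule ext) (rule eq)
  ultimately show ?case using lie_mono.bracket[OF IH g] by (simp only: odd_len_simps)
qed

lemma fun_sum_apply: "(\<Sum>x\<in>A. F x) w = (\<Sum>x\<in>A. F x w)"
  by (induction A rule: infinite_finite_induct) auto

lemma dynkin_in_free_lie_super:
  assumes W: "finite W" "\<And>w. w \<in> W \<Longrightarrow> w \<noteq> [] \<and> (\<forall>a\<in>set w. snd a < N)" and "\<And>w. w \<notin> W \<Longrightarrow> f w = 0"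
  shows "dynkin f \<in> free_lie_super N"
proof -
  have "f z = (\<Sum>w\<in>W. f w * unit_tensor w z)" for z
    using assms by (simp add: unit_tensor_def of_bool_def if_distrib cong: if_cong)
  then have f: "f = (\<lambda>z. \<Sum>w\<in>W. f w * unit_tensor w z)" by blast
  have "dynkin f v = (\<Sum>w\<in>W. f w * dynkin (unit_tensor w) v)" for v
    by (subst f) (rule dynkin_sum[OF W(1)])
  then have "dynkin f = (\<Sum>w\<in>W. tscale (f w) (dynkin (unit_tensor w)))"
    by (auto simp: fun_sum_apply tscale_def)
  also have "\<dots> \<in> free_lie_super N"
    unfolding free_lie_super_def
    using W lie_mono_dynkin_unit by (intro tens.span_sum tens.span_scale tens.span_base) blast
  finally show ?thesis .
qed

text \<open>The Koszul sign of reversing a word, with a factor -1 for every letter after the first,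
  as in the antipode of the shuffle algebra.\<close>

fun dynkin_sign :: "letter list \<Rightarrow> complex" where
  "dynkin_sign [] = 1"
| "dynkin_sign [a] = 1"
| "dynkin_sign (a # b # r) = - ((-1) ^ (odd_len [a] * odd_len (b # r)) * dynkin_sign (b # r))"

lemma dynkin_sign_snoc:
  "r \<noteq> [] \<Longrightarrow> dynkin_sign (r @ [h]) = - ((-1) ^ (odd_len [h] * odd_len r) * dynkin_sign r)"
  by (induction r rule: dynkin_sign.induct)
    (simp_all add: odd_len_Cons_if power_add algebra_simps)

text \<open>In a left-normed bracket every letter after the innermost one goes to the right or to
  the left end. So if the innermost letter comes to stand at position \<open>i\<close> of
  \<open>v\<close>, the original word is \<open>v ! i\<close> followed by a shuffle of the reversed
  left part with the right part.\<close>

lemma dynkin_expand: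
  "dynkin f v = (\<Sum>i<length v. dynkin_sign (rev (take (Suc i) v))
      * super_shuffle (\<lambda>z. f (v ! i # z)) (rev (take i v)) (drop (Suc i) v))"
proof (induction "length v" arbitrary: f v rule: less_induct)
  case less
  show ?case
  proof (cases v rule: word_cases)
    case (3 h m l)
    let ?k = "length m"
    let ?s = "(-1) ^ (odd_len [h] * odd_len (m @ [l])) :: complex"
    let ?A = "\<lambda>i. dynkin_sign (rev (take (Suc i) v))
      * super_shuffle (\<lambda>z. f (v ! i # z)) (rev (take i v)) (drop (Suc i) v)"
    let ?T = "\<lambda>i. dynkin_sign (rev (take (Suc i) (h # m)))
      * super_shuffle (\<lambda>z. f ((h # m) ! i # z @ [l])) (rev (take i (h # m))) (drop (Suc i) (h # m))"
    let ?U = "\<lambda>i. dynkin_sign (rev (take (Suc i) (m @ [l])))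
      * super_shuffle (\<lambda>z. f ((m @ [l]) ! i # z @ [h])) (rev (take i (m @ [l]))) (drop (Suc i) (m @ [l]))"
    have T: "dynkin (\<lambda>z. f (z @ [l])) (h # m) = (\<Sum>i<Suc ?k. ?T i)"
      using less[of "h # m" "\<lambda>z. f (z @ [l])"] by (simp add: 3)
    have U: "dynkin (\<lambda>z. f (z @ [h])) (m @ [l]) = (\<Sum>i<Suc ?k. ?U i)"
      using less[of "m @ [l]" "\<lambda>z. f (z @ [h])"] by (simp add: 3)
    have A0: "?A 0 = ?T 0" by (simp add: 3)
    have Al: "?A (Suc ?k) = - (?s * ?U ?k)"
      using dynkin_sign_snoc[of "l # rev m" h] by (simp add: 3 nth_append odd_len_Cons_if add.commute)
    \<comment> \<open>For an inner position the last letter of the shuffle is \<open>l\<close> or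
      \<open>h\<close>, which splits its term between the two recursive calls; the first and the
      last position contribute to one call each.\<close>
    have Am: "?A (Suc j) = ?T (Suc j) - ?s * ?U j" if "j < ?k" for j
    proof -
      let ?q = "drop (Suc j) m" and ?p = "rev (take j m)"
      have t: "take (Suc j) m = take j m @ [m ! j]" using that by (rule take_Suc_conv_app_nth)
      have "odd_len m = odd_len (take j m) + odd_len [m ! j] + odd_len ?q"
        using odd_len_take_drop[of "Suc j" m] t by simp
      then have s: "(-1) ^ (odd_len [h] * odd_len (?q @ [l])) * dynkin_sign (m ! j # ?p @ [h]) = - (?s * dynkin_sign (m ! j # ?p))"
        using dynkin_sign_snoc[of "m ! j # ?p" h] odd_len_Cons[of "m ! j" ?p]
        by (simp add: power_add distrib_left flip: power_add) (simp add: ac_simps)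
      have "?A (Suc j) = dynkin_sign (m ! j # ?p @ [h]) * super_shuffle (\<lambda>z. f (m ! j # z)) (?p @ [h]) (?q @ [l])"
        using that t by (simp add: 3 nth_append)
      also have "\<dots> = dynkin_sign (m ! j # ?p @ [h]) * super_shuffle (\<lambda>z. f (m ! j # z @ [l])) (?p @ [h]) ?q
         + (-1) ^ (odd_len [h] * odd_len (?q @ [l])) * dynkin_sign (m ! j # ?p @ [h]) * super_shuffle (\<lambda>z. f (m ! j # z @ [h])) ?p (?q @ [l])"
        unfolding super_shuffle_snoc by (simp add: distrib_left)
      also have "\<dots> = ?T (Suc j) - ?s * ?U j"
        unfolding s using that t by (simp add: nth_append)
      finally show ?thesis .
    qed
    have "(\<Sum>i<length v. ?A i) = ?A 0 + (\<Sum>j<?k. ?A (Suc j)) + ?A (Suc ?k)"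
    proof -
      have "length v = Suc (Suc ?k)" by (simp add: 3)
      then show ?thesis
        by (simp only: sum.lessThan_Suc_shift[of ?A "Suc ?k"] sum.lessThan_Suc[of "\<lambda>i. ?A (Suc i)" ?k] add.assoc)
    qed
    also have "\<dots> = ?T 0 + (\<Sum>j<?k. ?T (Suc j)) - ?s * ((\<Sum>j<?k. ?U j) + ?U ?k)"
      unfolding A0 Al using Am by (simp add: sum_subtractf sum_distrib_left distrib_left)
    also have "\<dots> = (\<Sum>i<Suc ?k. ?T i) - ?s * (\<Sum>i<Suc ?k. ?U i)"
      unfolding sum.lessThan_Suc_shift[of ?T] sum.lessThan_Suc[of ?U] by simp
    finally show ?thesis unfolding 3 dynkin_Cons_snoc T U by simp
  qed simp_all
qed

text \<open>Vanishing on the shuffles of \<open>b # r\<close> with \<open>a # q\<close> trades the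
  shuffles beginning with \<open>b\<close> for those beginning with \<open>a\<close>; done for every
  letter of \<open>r\<close>, this moves \<open>a\<close> to the front.\<close>

lemma primitive_antipode:
  assumes "primitive f"
  shows "f (rev r @ a # q) = dynkin_sign (a # r) * super_shuffle (\<lambda>z. f (a # z)) r q"
proof (induction r arbitrary: a q)
  case (Cons b r)
  have "super_shuffle f (b # r) (a # q) = 0" using assms unfolding primitive_def by blast
  then have "super_shuffle (\<lambda>z. f (b # z)) r (a # q) = - ((-1) ^ (odd_len [a] * odd_len (b # r)) * super_shuffle (\<lambda>z. f (a # z)) (b # r) q)"
    by (simp add: eq_neg_iff_add_eq_0)
  then show ?case using Cons.IH[of b "a # q"] by simp
qed simp

text \<open>Dynkin-Specht-Wever: by \<open>primitive_antipode\<close> each of the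
  \<open>length v\<close> summands of \<open>dynkin_expand\<close> equals
  \<open>f v\<close>.\<close>

theorem dynkin_primitive:
  assumes "primitive f"
  shows "dynkin f v = of_nat (length v) * f v"
proof -
  have "dynkin f v = (\<Sum>i<length v. f v)"
    unfolding dynkin_expand
  proof (intro sum.cong refl)
    fix i assume "i \<in> {..<length v}"
    then have "rev (take (Suc i) v) = v ! i # rev (take i v)" "v = take i v @ v ! i # drop (Suc i) v"
      by (simp_all add: take_Suc_conv_app_nth id_take_nth_drop)
    then show "dynkin_sign (rev (take (Suc i) v)) * super_shuffle (\<lambda>z. f (v ! i # z)) (rev (take i v)) (drop (Suc i) v) = f v"
      using primitive_antipode[OF assms, of "rev (take i v)" "v ! i" "drop (Suc i) v"] by simp
  qed
  then show ?thesis by simp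
qed

text \<open>Such an \<open>f\<close> is \<open>1 / d\<close> times its Dynkin image, and finite
  support makes that image a combination of left-normed brackets.\<close>

theorem primitive_in_free_lie_super:
  assumes "primitive f" "d > 0" "f \<in> letters_below N" "\<And>w. f w \<noteq> 0 \<Longrightarrow> length w = d"
  shows "f \<in> free_lie_super N"
proof -
  let ?W = "{w. set w \<subseteq> (UNIV :: bool set) \<times> {..<N} \<and> length w = d}"
  have "dynkin f \<in> free_lie_super N"
  proof (rule dynkin_in_free_lie_super)
    show "finite ?W" by (intro finite_lists_length_eq finite_cartesian_product) simp_all
    show "w \<noteq> [] \<and> (\<forall>a\<in>set w. snd a < N)" if "w \<in> ?W" for w using that assms(2) by force
    show "f w = 0" if "w \<notin> ?W" for w
      using that assms(3,4) unfolding letters_below_def by force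
  qed
  moreover have "f = tscale (1 / of_nat d) (dynkin f)"
  proof
    fix w
    show "f w = tscale (1 / of_nat d) (dynkin f) w"
      using assms(2) assms(4)[of w] by (cases "f w = 0") (simp_all add: tscale_def dynkin_primitive[OF assms(1)])
  qed
  moreover have "dynkin f \<in> free_lie_super N \<Longrightarrow> tscale (1 / of_nat d) (dynkin f) \<in> free_lie_super N"
    unfolding free_lie_super_def by (rule tens.span_scale)
  ultimately show ?thesis by simp
qed

section \<open>Stanley's shuffle theorem\<close>

text \<open>Gaussian binomial coefficients, given by the q-Pascal rule and not as a quotient, so
  that \<open>q\<close> may be a root of unity.\<close>

fun qbinom :: "complex \<Rightarrow> nat \<Rightarrow> nat \<Rightarrow> complex" where
  "qbinom q n 0 = 1"
| "qbinom q 0 (Suc k) = 0"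
| "qbinom q (Suc n) (Suc k) = qbinom q n k + q ^ Suc k * qbinom q n (Suc k)"

lemma qbinom_eq_0: "n < k \<Longrightarrow> qbinom q n k = 0"
  by (induction q n k rule: qbinom.induct) auto

lemma qbinom_self [simp]: "qbinom q n n = 1"
  by (induction n) (simp_all add: qbinom_eq_0)

text \<open>The mirrored q-Pascal rule; compared with the defining one it yields symmetry and
  absorption.\<close>

lemma qbinom_Suc_Suc':
  "k \<le> n \<Longrightarrow> qbinom q (Suc n) (Suc k) = qbinom q n (Suc k) + q ^ (n - k) * qbinom q n k"
proof (induction n arbitrary: k)
  case (Suc n)
  show ?case
  proof (cases k)
    case 0
    have "qbinom q (Suc n) (Suc 0) = qbinom q n (Suc 0) + q ^ n" using Suc.IH[of 0] by simp
    then show ?thesis unfolding 0 qbinom.simps(3)[of q "Suc n"] by (simp add: algebra_simps)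
  next
    case (Suc j)
    show ?thesis
    proof (cases "j = n")
      case True
      then show ?thesis using Suc qbinom_eq_0[of "Suc n" "Suc k" q] qbinom_self[of q "Suc k"]
        by (simp del: qbinom.simps(3))
    next
      case False
      then have j: "j \<le> n" "Suc j \<le> n" "n - j = Suc (n - Suc j)" using Suc Suc.prems by auto
      have p: "q ^ (n - j) * q ^ Suc j = q ^ Suc n" using j(1) by (simp flip: power_Suc power_add)
      have p': "q ^ Suc (Suc j) * q ^ (n - Suc j) = q ^ Suc n" using j(2) by (simp flip: power_Suc power_add)
      have "qbinom q (Suc (Suc n)) (Suc k) = qbinom q (Suc n) (Suc j) + q ^ Suc (Suc j) * qbinom q (Suc n) (Suc (Suc j))"
        by (simp add: Suc)
      also have "\<dots> = (qbinom q n (Suc j) + q ^ (n - j) * qbinom q n j)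
          + q ^ Suc (Suc j) * (qbinom q n (Suc (Suc j)) + q ^ (n - Suc j) * qbinom q n (Suc j))"
        by (simp only: Suc.IH[OF j(1)] Suc.IH[OF j(2)])
      also have "\<dots> = (qbinom q n (Suc j) + q ^ Suc (Suc j) * qbinom q n (Suc (Suc j)))
         + (q ^ (n - j) * qbinom q n j + q ^ Suc n * qbinom q n (Suc j))"
        unfolding p'[symmetric] by (simp only: distrib_left ac_simps)
      also have "\<dots> = qbinom q (Suc n) (Suc (Suc j)) + q ^ (n - j) * qbinom q (Suc n) (Suc j)"
        unfolding p[symmetric] qbinom.simps(3) by (simp only: distrib_left ac_simps)
      finally show ?thesis by (simp add: Suc)
    qed
  qed
qed simp

lemma qbinom_symmetric: "qbinom q (a + b) a = qbinom q (a + b) b"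
proof (induction "a + b" arbitrary: a b rule: less_induct)
  case less
  show ?case
  proof (cases a; cases b)
    fix i j assume ab: "a = Suc i" "b = Suc j"
    have "qbinom q (Suc (i + Suc j)) (Suc i) = qbinom q (i + Suc j) (Suc i) + q ^ (i + Suc j - i) * qbinom q (i + Suc j) i"
      by (rule qbinom_Suc_Suc') simp
    also have "qbinom q (i + Suc j) i = qbinom q (i + Suc j) (Suc j)" by (rule less) (simp add: ab)
    also have "qbinom q (i + Suc j) (Suc i) = qbinom q (i + Suc j) j"
      using less[of "Suc i" j] by (simp add: ab)
    finally show ?thesis using ab by simp
  qed simp_all
qed

lemma qbinom_absorb: "(1 - q ^ Suc k) * qbinom q (Suc n) (Suc k) = (1 - q ^ Suc n) * qbinom q n k"
proof (cases "k \<le> n")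
  case True
  have "q ^ Suc k * qbinom q (Suc n) (Suc k) = q ^ Suc k * qbinom q n (Suc k) + q ^ Suc k * q ^ (n - k) * qbinom q n k"
    by (simp only: qbinom_Suc_Suc'[OF True] distrib_left mult.assoc)
  also have "q ^ Suc k * q ^ (n - k) = q ^ Suc n" using True by (simp flip: power_Suc power_add)
  also have "q ^ Suc k * qbinom q n (Suc k) = qbinom q (Suc n) (Suc k) - qbinom q n k" by simp
  finally show ?thesis by (simp only: left_diff_distrib mult_1) simp
qed (simp add: qbinom_eq_0)

text \<open>In \<open>qbinom_absorb\<close> the factor \<open>1 - q ^ d\<close> on the right is zero
  while \<open>1 - q ^ k\<close> on the left is not.\<close>

lemma qbinom_root_of_unity:
  assumes "q ^ d = 1" "0 < k" "k < d" "q ^ k \<noteq> 1"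
  shows "qbinom q d k = 0"
  using assms qbinom_absorb[of q "k - 1" "d - 1"] by simp

text \<open>The list is read backwards, so that the recursion of \<^const>\<open>shuffles\<close>, which acts on
  heads, follows the last letters of the words.\<close>

fun rev_maj :: "complex \<Rightarrow> 'a :: linorder list \<Rightarrow> complex" where
  "rev_maj q [] = 1"
| "rev_maj q [y] = 1"
| "rev_maj q (y # x # r) = (if x > y then q ^ length (x # r) else 1) * rev_maj q (x # r)"

section \<open>Sums of powers given by the major index over shuffles\<close>

lemma sum_shuffles_Cons:
  assumes "x \<noteq> y"
  shows "(\<Sum>z\<in>shuffles (x # xs) (y # ys). F z) =
    (\<Sum>z\<in>shuffles xs (y # ys). F (x # z)) + (\<Sum>z\<in>shuffles (x # xs) ys. (F (y # z) :: 'b :: comm_monoid_add))"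
proof -
  have "(\<Sum>z\<in>shuffles (x # xs) (y # ys). F z) = sum F ((#) x ` shuffles xs (y # ys)) + sum F ((#) y ` shuffles (x # xs) ys)"
    unfolding shuffles.simps using assms by (intro sum.union_disjoint) auto
  then show ?thesis by (simp add: sum.reindex)
qed

text \<open>The shuffles split by their head into the two refined sums, which match the two terms of
  the q-Pascal rule; the second conclusion serves the opposite order of the heads, by symmetry of
  the coefficients.\<close>

lemma sum_shuffles_rev_maj:
  assumes "(\<Sum>z\<in>shuffles xs (y # ys). rev_maj q (x # z)) =
           rev_maj q (x # xs) * rev_maj q (y # ys) * qbinom q (length xs + Suc (length ys)) (length xs) \<and>
         (\<Sum>z\<in>shuffles (x # xs) ys. rev_maj q (y # z)) =
           rev_maj q (x # xs) * rev_maj q (y # ys) * q ^ Suc (length xs) * qbinom q (Suc (length xs) + length ys) (Suc (length xs))"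
    and "x \<noteq> y"
  shows "(\<Sum>z\<in>shuffles (x # xs) (y # ys). rev_maj q z) =
     rev_maj q (x # xs) * rev_maj q (y # ys) * qbinom q (Suc (length xs) + Suc (length ys)) (Suc (length xs))"
    and "(\<Sum>z\<in>shuffles (y # ys) (x # xs). rev_maj q z) =
     rev_maj q (y # ys) * rev_maj q (x # xs) * qbinom q (Suc (length ys) + Suc (length xs)) (Suc (length ys))"
proof -
  have "qbinom q (Suc (length xs) + Suc (length ys)) (Suc (length xs)) =
      qbinom q (length xs + Suc (length ys)) (length xs) + q ^ Suc (length xs) * qbinom q (Suc (length xs) + length ys) (Suc (length xs))"
    using qbinom.simps(3)[of q "length xs + Suc (length ys)" "length xs"] by (simp del: qbinom.simps(3))
  then show *: "(\<Sum>z\<in>shuffles (x # xs) (y # ys). rev_maj q z) =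
     rev_maj q (x # xs) * rev_maj q (y # ys) * qbinom q (Suc (length xs) + Suc (length ys)) (Suc (length xs))"
    using assms(1) by (simp only: sum_shuffles_Cons[OF assms(2)] distrib_left mult.assoc)
  have "qbinom q (Suc (length ys) + Suc (length xs)) (Suc (length ys)) = qbinom q (Suc (length xs) + Suc (length ys)) (Suc (length xs))"
    using qbinom_symmetric[of q "Suc (length ys)" "Suc (length xs)"] by (simp only: add.commute)
  then show "(\<Sum>z\<in>shuffles (y # ys) (x # xs). rev_maj q z) =
     rev_maj q (y # ys) * rev_maj q (x # xs) * qbinom q (Suc (length ys) + Suc (length xs)) (Suc (length ys))"
    using * by (simp only: shuffles_commutes[of "y # ys"] mult.commute[of "rev_maj q (y # ys)"])
qed

text \<open>Whether a further letter makes a descent depends on the head alone, so the induction has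
  to keep track of it. The greater head \<open>x\<close> gives the first term of the q-Pascal rule,
  the smaller head \<open>y\<close> the second.\<close>

lemma stanley_shuffle_refined:
  fixes x y :: "'a :: linorder"
  assumes "x > y" "distinct (x # xs @ y # ys)"
  shows "(\<Sum>z\<in>shuffles xs (y # ys). rev_maj q (x # z)) =
           rev_maj q (x # xs) * rev_maj q (y # ys) * qbinom q (length xs + Suc (length ys)) (length xs) \<and>
         (\<Sum>z\<in>shuffles (x # xs) ys. rev_maj q (y # z)) =
           rev_maj q (x # xs) * rev_maj q (y # ys) * q ^ Suc (length xs) * qbinom q (Suc (length xs) + length ys) (Suc (length xs))"
  using assms
proof (induction "length xs + length ys" arbitrary: x y xs ys rule: less_induct)
  case less
  let ?a = "length xs" and ?b = "length ys"
  let ?H = "\<lambda>x xs ys. \<Sum>z\<in>shuffles xs ys. rev_maj q (x # z)"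
  \<comment> \<open>The unrefined sum for shorter words, whichever head is greater.\<close>
  have G: "(\<Sum>z\<in>shuffles (x # xs) (y # ys). rev_maj q z) =
     rev_maj q (x # xs) * rev_maj q (y # ys) * qbinom q (Suc (length xs) + Suc (length ys)) (Suc (length xs))"
    if "length xs + length ys < ?a + ?b" "distinct (x # xs @ y # ys)" for x y :: 'a and xs ys
  proof (cases "x > y")
    case True
    show ?thesis by (rule sum_shuffles_rev_maj(1)[OF less.hyps[OF that(1) True that(2)]]) (use that in auto)
  next
    case False
    then have "y > x" using that(2) by auto
    moreover have "length ys + length xs < ?a + ?b" "distinct (y # ys @ x # xs)" using that by auto
    ultimately show ?thesis using less.hyps[of ys xs x y] by (intro sum_shuffles_rev_maj(2)) (use that in auto)
  qed
  \<comment> \<open>The letter after \<open>w\<close> in the list precedes it in the word, so it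
    makes a descent exactly if it is greater.\<close>
  have step: "(\<Sum>z\<in>shuffles (u # us) (v # vs). rev_maj q (w # z)) =
     (if u > w then q ^ (Suc (length us) + Suc (length vs)) else 1) * ?H u us (v # vs) +
     (if v > w then q ^ (Suc (length us) + Suc (length vs)) else 1) * ?H v (u # us) vs" if "u \<noteq> v" for u us v vs w
  proof -
    have "(\<Sum>z\<in>shuffles us (v # vs). rev_maj q (w # u # z)) = (if u > w then q ^ (Suc (length us) + Suc (length vs)) else 1) * ?H u us (v # vs)"
      by (auto simp: sum_distrib_left length_shuffles intro!: sum.cong)
    moreover have "(\<Sum>z\<in>shuffles (u # us) vs. rev_maj q (w # v # z)) = (if v > w then q ^ (Suc (length us) + Suc (length vs)) else 1) * ?H v (u # us) vs"
      by (auto simp: sum_distrib_left length_shuffles intro!: sum.cong)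
    ultimately show ?thesis unfolding sum_shuffles_Cons[OF that] by (simp only:)
  qed
  have "?H x xs (y # ys) = rev_maj q (x # xs) * rev_maj q (y # ys) * qbinom q (length xs + Suc (length ys)) (length xs)"
  proof (cases xs)
    case Nil
    then show ?thesis using less.prems(1) by (auto simp: shuffles_commutes[of _ "[]"])
  next
    case (Cons u us)
    have ne: "u \<noteq> y" using less.prems Cons by auto
    show ?thesis
    proof (cases "u > x")
      \<comment> \<open>Neither \<open>u\<close> nor \<open>y\<close> exceeds \<open>x\<close>, so
        prepending \<open>x\<close> makes no descent and the full sum applies.\<close>
      case False
      then have "?H x xs (y # ys) = (\<Sum>z\<in>shuffles (u # us) (y # ys). rev_maj q z)"
        unfolding Cons step[OF ne] sum_shuffles_Cons[OF ne] using less.prems(1) by simp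
      also have "\<dots> = rev_maj q xs * rev_maj q (y # ys) * qbinom q (Suc (length us) + Suc (length ys)) (Suc (length us))"
        using G[of us ys u y] less.prems Cons by simp
      finally show ?thesis using False Cons by simp
    next
      \<comment> \<open>Only the shuffles headed by \<open>u\<close> make a descent to
        \<open>x\<close>. As \<open>u > y\<close>, the refined hypothesis applies, and the mirrored
        q-Pascal rule recombines the two sums.\<close>
      case True
      then have "u > y" using less.prems(1) by simp
      have IH: "?H u us (y # ys) = rev_maj q (u # us) * rev_maj q (y # ys) * qbinom q (length us + Suc (length ys)) (length us)"
        "?H y (u # us) ys = rev_maj q (u # us) * rev_maj q (y # ys) * q ^ Suc (length us) * qbinom q (Suc (length us) + length ys) (Suc (length us))"
        using less.hyps[OF _ \<open>u > y\<close>, of us ys] less.prems Cons by auto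
      let ?n = "length us" and ?m = "Suc (length ys)"
      have "qbinom q (Suc (?n + ?m)) (Suc ?n) = qbinom q (?n + ?m) (Suc ?n) + q ^ ?m * qbinom q (?n + ?m) ?n"
        using qbinom_Suc_Suc'[of ?n "?n + ?m" q] by simp
      then have *: "q ^ (Suc ?n + ?m) * qbinom q (?n + ?m) ?n + q ^ Suc ?n * qbinom q (?n + ?m) (Suc ?n)
         = q ^ Suc ?n * qbinom q (Suc (?n + ?m)) (Suc ?n)"
        by (simp only: distrib_left power_add ac_simps)
      have "?H x xs (y # ys) = rev_maj q (u # us) * rev_maj q (y # ys) * (q ^ Suc ?n * qbinom q (Suc (?n + ?m)) (Suc ?n))"
        (is "_ = ?c * _")
      proof -
        have e: "Suc ?n + length ys = ?n + ?m" by simp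
        have "?H x xs (y # ys) = q ^ (Suc ?n + ?m) * (?c * qbinom q (?n + ?m) ?n)
            + ?c * q ^ Suc ?n * qbinom q (?n + ?m) (Suc ?n)"
          unfolding Cons step[OF ne] IH e using True less.prems(1) less_not_sym[OF less.prems(1)]
          by (simp del: qbinom.simps(3) power_Suc add_Suc add_Suc_right)
        also have "\<dots> = ?c * (q ^ (Suc ?n + ?m) * qbinom q (?n + ?m) ?n + q ^ Suc ?n * qbinom q (?n + ?m) (Suc ?n))"
          by (simp only: distrib_left ac_simps)
        finally show ?thesis unfolding * .
      qed
      then show ?thesis using True less_not_sym[OF True] by (simp add: Cons ac_simps del: qbinom.simps(3))
    qed
  qed
  moreover have "?H y (x # xs) ys = rev_maj q (x # xs) * rev_maj q (y # ys) * q ^ Suc (length xs) * qbinom q (Suc (length xs) + length ys) (Suc (length xs))"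
  proof (cases ys)
    case Nil
    then show ?thesis using less.prems(1) by (auto simp: shuffles_commutes[of _ "[]"])
  next
    case (Cons v vs)
    have ne: "x \<noteq> v" using less.prems Cons by auto
    let ?n = "length xs" and ?m = "Suc (length vs)"
    show ?thesis
    proof (cases "v > y")
      \<comment> \<open>Both \<open>x\<close> and \<open>v\<close> exceed \<open>y\<close>, so every
        shuffle makes a descent.\<close>
      case True
      then have "?H y (x # xs) ys = q ^ (Suc ?n + ?m) * (\<Sum>z\<in>shuffles (x # xs) (v # vs). rev_maj q z)"
        unfolding Cons step[OF ne] sum_shuffles_Cons[OF ne] using less.prems(1) by (simp add: distrib_left)
      also have "\<dots> = q ^ (Suc ?n + ?m) * (rev_maj q (x # xs) * rev_maj q ys * qbinom q (Suc ?n + ?m) (Suc ?n))"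
        using G[of xs vs x v] less.prems Cons by simp
      finally show ?thesis using True Cons by (simp add: power_add ac_simps)
    next
      case False
      then have "v < y" using less.prems Cons by auto
      then have "x > v" using less.prems(1) by simp
      have IH: "?H x xs (v # vs) = rev_maj q (x # xs) * rev_maj q (v # vs) * qbinom q (?n + ?m) ?n"
        "?H v (x # xs) vs = rev_maj q (x # xs) * rev_maj q (v # vs) * q ^ Suc ?n * qbinom q (Suc ?n + length vs) (Suc ?n)"
        using less.hyps[OF _ \<open>x > v\<close>, of xs vs] less.prems Cons by auto
      have "qbinom q (Suc (?n + ?m)) (Suc ?n) = qbinom q (?n + ?m) (Suc ?n) + q ^ ?m * qbinom q (?n + ?m) ?n"
        using qbinom_Suc_Suc'[of ?n "?n + ?m" q] by simp
      then have *: "q ^ (Suc ?n + ?m) * qbinom q (?n + ?m) ?n + q ^ Suc ?n * qbinom q (?n + ?m) (Suc ?n)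
         = q ^ Suc ?n * qbinom q (Suc (?n + ?m)) (Suc ?n)"
        by (simp only: distrib_left power_add ac_simps)
      have "?H y (x # xs) ys = rev_maj q (x # xs) * rev_maj q (v # vs) * (q ^ Suc ?n * qbinom q (Suc (?n + ?m)) (Suc ?n))"
        (is "_ = ?c * _")
      proof -
        have e: "Suc ?n + length vs = ?n + ?m" by simp
        have "?H y (x # xs) ys = q ^ (Suc ?n + ?m) * (?c * qbinom q (?n + ?m) ?n)
            + ?c * q ^ Suc ?n * qbinom q (?n + ?m) (Suc ?n)"
          unfolding Cons step[OF ne] IH e using less_not_sym[OF \<open>v < y\<close>] less.prems(1)
          by (simp del: qbinom.simps(3) power_Suc add_Suc add_Suc_right)
        also have "\<dots> = ?c * (q ^ (Suc ?n + ?m) * qbinom q (?n + ?m) ?n + q ^ Suc ?n * qbinom q (?n + ?m) (Suc ?n))"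
          by (simp only: distrib_left ac_simps)
        finally show ?thesis unfolding * .
      qed
      then show ?thesis using less_not_sym[OF \<open>v < y\<close>] by (simp add: Cons ac_simps del: qbinom.simps(3))
    qed
  qed
  ultimately show ?case ..
qed

theorem stanley_shuffle:
  fixes xs ys :: "'a :: linorder list"
  assumes "distinct (xs @ ys)"
  shows "(\<Sum>z\<in>shuffles xs ys. rev_maj q z) =
           rev_maj q xs * rev_maj q ys * qbinom q (length xs + length ys) (length xs)"
proof (cases xs; cases ys)
  fix x xs' y ys' assume e: "xs = x # xs'" "ys = y # ys'"
  then have ne: "x \<noteq> y" using assms by auto
  show ?thesis
  proof (cases "x > y")
    case True
    then show ?thesis using sum_shuffles_rev_maj(1)[OF stanley_shuffle_refined[OF True, of xs' ys' q] ne] assms e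
      by (simp only: list.size) simp
  next
    case False
    then have "y > x" using ne by auto
    moreover have "distinct (y # ys' @ x # xs')" using assms e by auto
    ultimately show ?thesis using sum_shuffles_rev_maj(2)[OF stanley_shuffle_refined ne[symmetric], of ys' xs' q] e
      by (simp only: list.size) simp
  qed
qed (simp_all add: shuffles_commutes[of _ "[]"])

section \<open>Descents at a primitive root of unity\<close>

text \<open>The product of the X - q^i is X^d - 1, both being monic of degree \<open>d\<close> with
  the same \<open>d\<close> roots; cancelling X - 1 and evaluating at 1 gives
  \<open>d\<close>.\<close>

lemma prod_one_minus_primitive_root:
  fixes q :: complex
  assumes d: "d > 0" "q ^ d = 1" "\<And>k. 0 < k \<Longrightarrow> k < d \<Longrightarrow> q ^ k \<noteq> 1"
  shows "(\<Prod>i<d - 1. 1 - q ^ Suc i) = of_nat d"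
proof -
  have "q \<noteq> 0" using d by (auto simp: power_0_left)
  have inj: "inj_on (\<lambda>i. q ^ i) {..<d}"
  proof (rule linorder_inj_onI)
    fix i j assume ij: "i < j" "i \<in> {..<d}" "j \<in> {..<d}"
    have "q ^ j = q ^ i * q ^ (j - i)" using ij by (simp flip: power_add)
    moreover have "q ^ (j - i) \<noteq> 1" using ij by (intro d(3)) auto
    ultimately show "q ^ i \<noteq> q ^ j" using \<open>q \<noteq> 0\<close> by simp
  qed (rule linear)
  have sub: "(\<lambda>i. q ^ i) ` {..<d} \<subseteq> {z. z ^ d = 1}"
    using d(2) by (auto simp: power_commutes simp flip: power_mult) (simp add: mult.commute[of _ d] power_mult)
  have "card ((\<lambda>i. q ^ i) ` {..<d}) = card {z :: complex. z ^ d = 1}"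
    using inj d(1) by (simp add: card_image card_roots_unity_eq)
  let ?P = "\<Prod>i<d. [:- (q ^ i), 1:]"
  have "?P = monom 1 d - 1"
  proof (rule poly_eqI_degree_lead_coeff[of _ d _ "(\<lambda>i. q ^ i) ` {..<d}"])
    have deg: "degree ?P = d" by (simp add: degree_prod_sum_eq)
    show "degree ?P \<le> d" using deg by simp
    have "lead_coeff ?P = 1" by (simp add: lead_coeff_prod)
    then show "coeff ?P d = coeff (monom 1 d - 1) d" using deg d(1) by simp
    show "degree (monom 1 d - 1 :: complex poly) \<le> d"
      by (intro degree_diff_le) (simp_all add: degree_monom_le)
    show "d \<le> card ((\<lambda>i. q ^ i) ` {..<d})" using inj by (simp add: card_image)
    show "poly ?P z = poly (monom 1 d - 1) z" if "z \<in> (\<lambda>i. q ^ i) ` {..<d}" for z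
    proof -
      obtain i where i: "i < d" "z = q ^ i" using \<open>z \<in> _\<close> by blast
      then have "(\<Prod>j<d. z - q ^ j) = 0" by auto
      moreover have "z ^ d = 1" using that sub by blast
      ultimately show ?thesis by (simp add: poly_prod poly_monom)
    qed
  qed
  also have "\<dots> = [:-1, 1:] * (\<Sum>i<d. monom 1 i)"
  proof -
    have "poly (monom 1 d - 1) x = poly ([:-1, 1:] * (\<Sum>i<d. monom 1 i)) x" for x :: complex
      by (simp add: poly_monom poly_sum power_diff_1_eq algebra_simps)
    then show ?thesis by (intro poly_eq_poly_eq_iff[THEN iffD1] ext)
  qed
  finally have "(\<Prod>i<Suc (d - 1). [:- (q ^ i), 1:]) = [:-1, 1:] * (\<Sum>i<d. monom 1 i)" using d(1) by simp
  then have "[:-1, 1:] * (\<Prod>i<d - 1. [:- (q ^ Suc i), 1:]) = [:-1, 1:] * (\<Sum>i<d. monom 1 i)"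
    unfolding prod.lessThan_Suc_shift by simp
  then have "(\<Prod>i<d - 1. [:- (q ^ Suc i), 1:]) = (\<Sum>i<d. monom 1 i)"
    by (subst (asm) mult_cancel_left) simp
  then have "poly (\<Prod>i<d - 1. [:- (q ^ Suc i), 1:]) 1 = poly (\<Sum>i<d. monom 1 i) 1" by simp
  then show ?thesis by (simp add: poly_prod poly_sum poly_monom)
qed

section \<open>Shuffles under reversal and relabelling\<close>

lemma shuffles_snoc1: "z \<in> shuffles xs ys \<Longrightarrow> z @ [a] \<in> shuffles (xs @ [a]) ys"
proof (induction xs ys arbitrary: z rule: shuffles.induct)
  case (1 ys)
  then show ?case by (induction ys arbitrary: z) auto
qed auto

lemma shuffles_snoc2: "z \<in> shuffles xs ys \<Longrightarrow> z @ [a] \<in> shuffles xs (ys @ [a])"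
  using shuffles_snoc1[of z ys xs a] by (simp add: shuffles_commutes)

lemma rev_in_shuffles: "z \<in> shuffles xs ys \<Longrightarrow> rev z \<in> shuffles (rev xs) (rev ys)"
proof (induction xs ys arbitrary: z rule: shuffles.induct)
  case (3 x xs y ys)
  then consider z' where "z = x # z'" "z' \<in> shuffles xs (y # ys)" | z' where "z = y # z'" "z' \<in> shuffles (x # xs) ys"
    by auto
  then show ?case
    by cases (use "3.IH" shuffles_snoc1 shuffles_snoc2 in \<open>metis rev.simps(2)\<close>)+
qed auto

lemma rev_shuffles: "rev ` shuffles xs ys = shuffles (rev xs) (rev ys)"
proof
  show "shuffles (rev xs) (rev ys) \<subseteq> rev ` shuffles xs ys"
  proof
    fix z assume "z \<in> shuffles (rev xs) (rev ys)"
    then have "rev z \<in> shuffles xs ys" using rev_in_shuffles by fastforce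
    then show "z \<in> rev ` shuffles xs ys" by (metis imageI rev_rev_ident)
  qed
qed (auto intro: rev_in_shuffles)

lemma map_shuffles: "map f ` shuffles xs ys = shuffles (map f xs) (map f ys)"
proof (induction xs ys rule: shuffles.induct)
  case (3 x xs y ys)
  have *: "map f ` (#) a ` A = (#) (f a) ` map f ` A" for a A by (simp add: image_image)
  show ?case by (simp only: shuffles.simps image_Un * "3.IH" list.map)
qed auto

text \<open>The power of \<open>q\<close> given by the major index; list indices start at 0, descent
  positions at 1.\<close>

definition desc_weight :: "complex \<Rightarrow> 'a :: linorder list \<Rightarrow> complex" where
  "desc_weight q z = (\<Prod>i<length z - 1. if z ! i > z ! Suc i then q ^ Suc i else 1)"

lemma desc_weight_eq: "desc_weight q z = rev_maj q (rev z)"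
proof (induction "rev z" arbitrary: z rule: rev_maj.induct)
  case (3 q y x r)
  define u where "u = rev r @ [x]"
  have z: "z = u @ [y]" using 3(2) by (metis rev_rev_ident rev.simps(2) u_def)
  have IH: "desc_weight q u = rev_maj q (rev u)" using 3(1)[of u] by (simp add: u_def)
  have "desc_weight q z = (\<Prod>i<Suc (length r). if z ! i > z ! Suc i then q ^ Suc i else 1)"
    by (simp add: desc_weight_def z u_def)
  also have "\<dots> = (\<Prod>i<length r. if u ! i > u ! Suc i then q ^ Suc i else 1) * (if x > y then q ^ Suc (length r) else 1)"
    unfolding prod.lessThan_Suc
    by (intro arg_cong2[of _ _ _ _ "(*)"] prod.cong) (auto simp: z u_def nth_append)
  also have "(\<Prod>i<length r. if u ! i > u ! Suc i then q ^ Suc i else 1) = desc_weight q u"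
    by (simp add: desc_weight_def u_def)
  finally show ?case unfolding IH by (simp add: z u_def)
qed (simp_all add: desc_weight_def)

text \<open>For distinct letters Stanley's theorem gives a multiple of a Gaussian binomial
  coefficient that vanishes at a primitive root.\<close>

lemma sum_shuffles_desc_weight:
  fixes xs ys :: "nat list"
  assumes "distinct (xs @ ys)" "xs \<noteq> []" "ys \<noteq> []"
    and q: "q ^ (length xs + length ys) = 1" "\<And>k. 0 < k \<Longrightarrow> k < length xs + length ys \<Longrightarrow> q ^ k \<noteq> 1"
  shows "(\<Sum>z\<in>shuffles xs ys. desc_weight q z) = 0"
proof -
  have "(\<Sum>z\<in>shuffles xs ys. desc_weight q z) = (\<Sum>z\<in>rev ` shuffles xs ys. rev_maj q z)"
    by (subst sum.reindex) (auto simp: desc_weight_eq inj_on_def)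
  also have "\<dots> = rev_maj q (rev xs) * rev_maj q (rev ys) * qbinom q (length xs + length ys) (length xs)"
    unfolding rev_shuffles using assms(1) stanley_shuffle[of "rev xs" "rev ys" q] by auto
  also have "qbinom q (length xs + length ys) (length xs) = 0"
    using assms by (intro qbinom_root_of_unity q) auto
  finally show ?thesis by simp
qed

section \<open>Relative order of entries and descents of the inverse\<close>

fun before :: "'a list \<Rightarrow> 'a \<Rightarrow> 'a \<Rightarrow> bool" where
  "before [] i j = False"
| "before (a # z) i j = (if a = i then j \<in> set z else before z i j)"

lemma before_filter: "P i \<Longrightarrow> P j \<Longrightarrow> before (filter P z) i j = before z i j"
  by (induction z) auto

lemma before_set: "before z i j \<Longrightarrow> i \<in> set z \<and> j \<in> set z"
  by (induction z) (auto split: if_splits)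

lemma before_nth: "distinct z \<Longrightarrow> a < length z \<Longrightarrow> b < length z \<Longrightarrow> before z (z ! a) (z ! b) \<longleftrightarrow> a < b"
proof (induction z arbitrary: a b)
  case (Cons x z)
  then show ?case using before_set[of z]
    by (cases a; cases b) (auto simp: nth_Cons)
qed simp

definition orderings :: "nat \<Rightarrow> nat list set" where
  "orderings d = {z. distinct z \<and> set z = {..<d}}"

lemma length_orderings: "z \<in> orderings d \<Longrightarrow> length z = d"
  using distinct_card[of z] by (simp add: orderings_def)

lemma finite_orderings [simp]: "finite (orderings d)"
proof (rule finite_subset)
  show "orderings d \<subseteq> {z. set z \<subseteq> {..<d} \<and> length z = d}"
    using length_orderings by (auto simp: orderings_def)
qed (simp add: finite_lists_length_eq)

lemma bij_betw_orderings: "bij_betw (\<lambda>s. map s [0..<d]) {s. s permutes {..<d}} (orderings d)"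
  unfolding bij_betw_def
proof
  show "inj_on (\<lambda>s. map s [0..<d]) {s. s permutes {..<d}}"
  proof (rule inj_onI)
    fix s t assume st: "s \<in> {s. s permutes {..<d}}" "t \<in> {s. s permutes {..<d}}" "map s [0..<d] = map t [0..<d]"
    then have "s i = t i" if "i < d" for i using that by auto
    moreover have "s i = t i" if "\<not> i < d" for i using that st by (simp add: permutes_def)
    ultimately show "s = t" by blast
  qed
  show "(\<lambda>s. map s [0..<d]) ` {s. s permutes {..<d}} = orderings d"
  proof
    show "(\<lambda>s. map s [0..<d]) ` {s. s permutes {..<d}} \<subseteq> orderings d"
    proof (rule image_subsetI)
      fix s assume "s \<in> {s. s permutes {..<d}}"
      then have s: "s permutes {..<d}" by simp
      have "inj_on s {0..<d}" using permutes_inj_on[OF s] .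
      then show "map s [0..<d] \<in> orderings d"
        using permutes_image[OF s] by (simp add: orderings_def distinct_map atLeast0LessThan)
    qed
    show "orderings d \<subseteq> (\<lambda>s. map s [0..<d]) ` {s. s permutes {..<d}}"
    proof
      fix z assume z: "z \<in> orderings d"
      define s where "s = (\<lambda>i. if i < d then z ! i else i)"
      have l: "length z = d" by (rule length_orderings[OF z])
      have "bij_betw ((!) z) {..<d} {..<d}"
        using z l by (intro bij_betw_nth) (auto simp: orderings_def)
      then have "bij_betw s {..<d} {..<d}" by (rule bij_betw_cong[THEN iffD1, rotated]) (simp add: s_def)
      then have "s permutes {..<d}" by (rule bij_imp_permutes) (simp add: s_def)
      moreover have "z = map s [0..<d]" using l by (intro nth_equalityI) (auto simp: s_def)
      ultimately show "z \<in> (\<lambda>s. map s [0..<d]) ` {s. s permutes {..<d}}" by blast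
    qed
  qed
qed

text \<open>Every ordering of \<^term>\<open>{..<d}\<close> is a shuffle of its restrictions to \<^term>\<open>{..<k}\<close>
  and to its complement.\<close>

lemma sum_orderings_shuffles:
  fixes F :: "nat list \<Rightarrow> complex"
  assumes F: "\<And>xs ys. xs @ ys \<in> orderings d \<Longrightarrow> xs \<noteq> [] \<Longrightarrow> ys \<noteq> [] \<Longrightarrow> (\<Sum>z\<in>shuffles xs ys. F z) = 0"
    and k: "0 < k" "k < d"
    and h: "\<And>z z'. filter (\<lambda>i. i < k) z = filter (\<lambda>i. i < k) z' \<Longrightarrow>
      filter (\<lambda>i. \<not> i < k) z = filter (\<lambda>i. \<not> i < k) z' \<Longrightarrow> h z = (h z' :: complex)"
  shows "(\<Sum>z\<in>orderings d. h z * F z) = 0"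
proof -
  let ?g = "partition (\<lambda>i. i < k)"
  \<comment> \<open>The orderings are grouped by their two restrictions; each group is the set of
    shuffles of a pair, and \<open>h\<close> is constant on it.\<close>
  have "(\<Sum>z\<in>orderings d. h z * F z) = (\<Sum>p\<in>?g ` orderings d. \<Sum>z\<in>{z \<in> orderings d. ?g z = p}. h z * F z)"
    by (rule sum.image_gen) simp
  also have "\<dots> = (\<Sum>p\<in>?g ` orderings d. 0)"
  proof (intro sum.cong refl)
    fix p assume "p \<in> ?g ` orderings d"
    then obtain z0 where z0: "z0 \<in> orderings d" "p = ?g z0" by blast
    let ?xs = "filter (\<lambda>i. i < k) z0" and ?ys = "filter (\<lambda>i. \<not> i < k) z0"
    have p: "p = (?xs, ?ys)" by (simp add: z0 o_def)
    have o: "?xs @ ?ys \<in> orderings d" using z0(1) by (auto simp: orderings_def)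
    have "0 \<in> set z0" "k \<in> set z0" using z0(1) k by (auto simp: orderings_def)
    then have ne: "?xs \<noteq> []" "?ys \<noteq> []" using k by (auto simp: filter_empty_conv)
    have sh: "?g -` {(?xs, ?ys)} = shuffles ?xs ?ys"
      by (rule inv_image_partition) auto
    have "{z \<in> orderings d. ?g z = p} = shuffles ?xs ?ys"
    proof -
      have "z \<in> orderings d" if "z \<in> shuffles ?xs ?ys" for z
      proof -
        have "distinct z" using that z0(1) by (intro distinct_disjoint_shuffles[OF _ _ _ that]) (auto simp: orderings_def)
        then show ?thesis using set_shuffles[OF that] o by (auto simp: orderings_def)
      qed
      then show ?thesis using sh unfolding p by (auto simp del: partition_filter_conv)
    qed
    moreover have "h z = h z0" if "z \<in> shuffles ?xs ?ys" for z
    proof -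
      have "?g z = (?xs, ?ys)" using that sh by blast
      then show ?thesis by (intro h) (simp_all add: o_def)
    qed
    ultimately have "(\<Sum>z\<in>{z \<in> orderings d. ?g z = p}. h z * F z) = (\<Sum>z\<in>shuffles ?xs ?ys. h z0 * F z)"
      by (intro sum.cong) auto
    also have "\<dots> = h z0 * (\<Sum>z\<in>shuffles ?xs ?ys. F z)" by (simp add: sum_distrib_left)
    finally show "(\<Sum>z\<in>{z \<in> orderings d. ?g z = p}. h z * F z) = 0"
      using F[OF o ne] by simp
  qed
  finally show ?thesis by simp
qed

text \<open>Here \<open>i\<close> is a descent of the inverse permutation iff \<open>Suc i\<close> precedes \<open>i\<close>.\<close>

definition inv_desc_weight :: "complex \<Rightarrow> nat list \<Rightarrow> complex" where
  "inv_desc_weight q z = (\<Prod>i<length z - 1. if before z (Suc i) i then q ^ Suc i else 1)"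

text \<open>The positions of 0, 1, ... increase, so the inverse permutation is increasing and hence
  the identity.\<close>

lemma orderings_sorted:
  assumes "z \<in> orderings d" "\<And>i. i < d - 1 \<Longrightarrow> before z i (Suc i)"
  shows "z = [0..<d]"
proof -
  obtain s where s: "s permutes {..<d}" "z = map s [0..<d]"
    using assms(1) bij_betw_orderings[of d] unfolding bij_betw_def by blast
  have dz: "distinct z" using assms(1) by (simp add: orderings_def)
  have lt: "inv s i < d" if "i < d" for i using permutes_in_image[OF permutes_inv[OF s(1)], of i] that by simp
  have zi: "z ! inv s i = i" if "i < d" for i using lt[OF that] s by (simp add: permutes_inverses(1)[OF s(1)])
  have "inv s i < inv s (Suc i)" if "i < d - 1" for i
    using assms(2)[OF that] before_nth[OF dz, of "inv s i" "inv s (Suc i)"] lt[of i] lt[of "Suc i"] that zi[of i] zi[of "Suc i"] s(2)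
    by simp
  then have "sorted_wrt (<) (map (inv s) [0..<d])"
    by (simp add: sorted_wrt_iff_nth_Suc_transp[OF transp_on_less])
  moreover have "map (inv s) [0..<d] \<in> orderings d"
    using bij_betw_orderings[of d] permutes_inv[OF s(1)] unfolding bij_betw_def by blast
  ultimately have "map (inv s) [0..<d] = [0..<d]"
    by (intro sorted_distinct_set_unique) (auto simp: orderings_def strict_sorted_iff)
  then have "inv s i = i" if "i < d" for i using that by (metis add_0 diff_zero length_upt nth_map nth_upt)
  then show ?thesis using zi s(2) by (intro nth_equalityI) auto
qed

text \<open>The factors are replaced one by one: a factor is a constant plus
  \<open>1 - q ^ Suc j\<close> times the indicator of the ascent at \<open>j\<close>, and the
  constant part sums to zero. With all of them replaced only the identity ordering remains.\<close>

lemma sum_orderings_inv_desc_weight: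
  fixes F :: "nat list \<Rightarrow> complex"
  assumes F: "\<And>xs ys. xs @ ys \<in> orderings d \<Longrightarrow> xs \<noteq> [] \<Longrightarrow> ys \<noteq> [] \<Longrightarrow> (\<Sum>z\<in>shuffles xs ys. F z) = 0"
  shows "(\<Sum>z\<in>orderings d. inv_desc_weight q z * F z) = (\<Prod>i<d - 1. 1 - q ^ Suc i) * F [0..<d]"
proof -
  define A where "A = (\<lambda>z i. if before z i (Suc i) then 1 - q ^ Suc i else (0::complex))"
  define B where "B = (\<lambda>z i. if before z (Suc i) i then q ^ Suc i else (1::complex))"
  \<comment> \<open>In \<open>G j\<close> the first \<open>j\<close> factors are already replaced by
    weighted ascent indicators.\<close>
  define G where "G = (\<lambda>j z. \<Prod>i<d - 1. if i < j then A z i else B z i)"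
  have AB: "B z j = q ^ Suc j + A z j" if "z \<in> orderings d" "j < d - 1" for z j
  proof -
    have dz: "distinct z" using that by (simp add: orderings_def)
    have "j \<in> set z" "Suc j \<in> set z" using that by (auto simp: orderings_def)
    then obtain a b where ab: "a < length z" "b < length z" "z ! a = j" "z ! b = Suc j"
      unfolding in_set_conv_nth by blast
    then have "a \<noteq> b" by auto
    then show ?thesis using before_nth[OF dz ab(1,2)] before_nth[OF dz ab(2,1)] ab
      by (auto simp: A_def B_def)
  qed
  have step: "(\<Sum>z\<in>orderings d. G j z * F z) = (\<Sum>z\<in>orderings d. G (Suc j) z * F z)" if j: "j < d - 1" for j
  proof -
    define h where "h = (\<lambda>z. q ^ Suc j * (\<Prod>i\<in>{..<d - 1} - {j}. if i < j then A z i else B z i))"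
    have G: "G j z = h z + G (Suc j) z" if "z \<in> orderings d" for z
    proof -
      have p: "(\<Prod>i\<in>{..<d - 1} - {j}. if i < Suc j then A z i else B z i) = (\<Prod>i\<in>{..<d - 1} - {j}. if i < j then A z i else B z i)"
        by (intro prod.cong) auto
      show ?thesis
        using prod.remove[of "{..<d - 1}" j "\<lambda>i. if i < j then A z i else B z i"]
          prod.remove[of "{..<d - 1}" j "\<lambda>i. if i < Suc j then A z i else B z i"] j p
        by (simp add: G_def h_def AB[OF that j] distrib_right)
    qed
    \<comment> \<open>Without its factor \<open>j\<close> the product only compares entries on the
      same side of the gap between \<open>j\<close> and \<open>Suc j\<close>, so it depends on the
      two restrictions alone.\<close>
    have "(\<Sum>z\<in>orderings d. h z * F z) = 0"
    proof (rule sum_orderings_shuffles[OF F])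
      fix z z' :: "nat list"
      assume e: "filter (\<lambda>i. i < Suc j) z = filter (\<lambda>i. i < Suc j) z'" "filter (\<lambda>i. \<not> i < Suc j) z = filter (\<lambda>i. \<not> i < Suc j) z'"
      have b: "before z a b = before z' a b" if "a < Suc j \<longleftrightarrow> b < Suc j" for a b
        using that before_filter[of "\<lambda>i. i < Suc j" a b z] before_filter[of "\<lambda>i. i < Suc j" a b z']
          before_filter[of "\<lambda>i. \<not> i < Suc j" a b z] before_filter[of "\<lambda>i. \<not> i < Suc j" a b z'] e
        by (cases "a < Suc j") simp_all
      show "h z = h z'" unfolding h_def A_def B_def
        by (intro arg_cong2[of _ _ _ _ "(*)"] prod.cong refl) (use b in auto)
    qed (use j in auto)
    then show ?thesis using G by (simp add: distrib_right sum.distrib)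
  qed
  have "(\<Sum>z\<in>orderings d. G 0 z * F z) = (\<Sum>z\<in>orderings d. G j z * F z)" if "j \<le> d - 1" for j
    using that by (induction j) (simp_all add: step)
  from this[of "d - 1"] have "(\<Sum>z\<in>orderings d. G 0 z * F z) = (\<Sum>z\<in>orderings d. G (d - 1) z * F z)" by simp
  also have "(\<Sum>z\<in>orderings d. G 0 z * F z) = (\<Sum>z\<in>orderings d. inv_desc_weight q z * F z)"
    by (intro sum.cong) (auto simp: G_def B_def inv_desc_weight_def length_orderings)
  also have "(\<Sum>z\<in>orderings d. G (d - 1) z * F z) = (\<Sum>z\<in>orderings d. if z = [0..<d] then (\<Prod>i<d - 1. 1 - q ^ Suc i) * F z else 0)"
  proof (intro sum.cong refl)
    fix z assume z: "z \<in> orderings d"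
    show "G (d - 1) z * F z = (if z = [0..<d] then (\<Prod>i<d - 1. 1 - q ^ Suc i) * F z else 0)"
    proof (cases "z = [0..<d]")
      case True
      have "before z i (Suc i)" if "i < d - 1" for i
        using before_nth[of z i "Suc i"] that by (simp add: True)
      then show ?thesis using True by (simp add: G_def A_def)
    next
      case False
      then obtain i where "i < d - 1" "\<not> before z i (Suc i)" using orderings_sorted[OF z] by blast
      then have "G (d - 1) z = 0" by (auto simp: G_def A_def intro!: prod_zero)
      then show ?thesis using False by simp
    qed
  qed
  also have "\<dots> = (\<Prod>i<d - 1. 1 - q ^ Suc i) * F [0..<d]"
  proof -
    have "[0..<d] \<in> orderings d" by (auto simp: orderings_def)
    then show ?thesis by simp
  qed
  finally show ?thesis .
qed

section \<open>Signed place permutations and Klyachko's operator\<close>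

definition swap_sign :: "(nat \<Rightarrow> bool) \<Rightarrow> nat \<Rightarrow> nat \<Rightarrow> complex" where
  "swap_sign p a b = (if b < a \<and> p a \<and> p b then - 1 else 1)"

text \<open>Koszul sign of rearranging a word into the order \<open>z\<close> of its positions: -1
  for every inversion between positions of odd letters.\<close>

fun koszul :: "(nat \<Rightarrow> bool) \<Rightarrow> nat list \<Rightarrow> complex" where
  "koszul p [] = 1"
| "koszul p (a # z) = (\<Prod>b\<leftarrow>z. swap_sign p a b) * koszul p z"

text \<open>Moving \<open>b\<close> to the front changes its order with the entries of
  \<open>u\<close> only, and of the two orders of two odd positions just one is an
  inversion.\<close>

lemma koszul_move:
  "distinct (u @ b # v) \<Longrightarrow>
    koszul p (u @ b # v) = (-1) ^ (of_bool (p b) * length (filter p u)) * koszul p (b # u @ v)"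
proof (induction u)
  case (Cons a u)
  have sw: "swap_sign p a b = (-1) ^ (of_bool (p b) * of_bool (p a)) * swap_sign p b a"
    using Cons.prems by (auto simp: swap_sign_def)
  have "koszul p ((a # u) @ b # v) = (\<Prod>c\<leftarrow>u @ b # v. swap_sign p a c) *
     ((-1) ^ (of_bool (p b) * length (filter p u)) * koszul p (b # u @ v))"
    using Cons by simp
  also have "\<dots> = swap_sign p a b * (-1) ^ (of_bool (p b) * length (filter p u)) *
     ((\<Prod>c\<leftarrow>u @ v. swap_sign p a c) * koszul p (b # u @ v))"
    by simp
  also have "\<dots> = (-1) ^ (of_bool (p b) * length (filter p (a # u))) * koszul p (b # (a # u) @ v)"
    unfolding sw by (simp add: power_add)
  finally show ?case .
qed simp

lemma koszul_prod: "koszul p z = (\<Prod>j<length z. \<Prod>i<j. swap_sign p (z ! i) (z ! j))"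
proof (induction z)
  case (Cons a z)
  have "(\<Prod>b\<leftarrow>z. swap_sign p a b) = (\<Prod>j<length z. swap_sign p a (z ! j))"
    by (simp add: prod.list_conv_set_nth atLeast0LessThan)
  then show ?case using Cons
    by (simp add: prod.lessThan_Suc_shift prod.distrib del: prod.lessThan_Suc)
qed simp

lemma koszul_upt: "koszul p [0..<d] = 1"
  unfolding koszul_prod by (intro prod.neutral ballI) (auto simp: swap_sign_def)

text \<open>Letters of \<open>w\<close> may repeat, their positions do not; shuffling positions
  therefore counts every shuffle once although \<open>shuffles\<close> is a set.\<close>

lemma sum_shuffles_koszul:
  fixes w :: "letter list"
  assumes "distinct (xs @ ys)"
  defines "p \<equiv> \<lambda>i. fst (w ! i)"
  shows "(\<Sum>z\<in>shuffles xs ys. koszul p z * f (map ((!) w) z)) =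
    koszul p (xs @ ys) * super_shuffle f (map ((!) w) xs) (map ((!) w) ys)"
  using assms(1)
proof (induction xs ys arbitrary: f rule: shuffles.induct)
  case (3 a xs b ys)
  have ol: "odd_len (map ((!) w) u) = length (filter p u)" for u
    by (simp add: odd_len_def p_def filter_map o_def)
  \<comment> \<open>The signs of \<open>c\<close> against the later entries depend only on the set
    of these, which is the same for all shuffles.\<close>
  have K: "koszul p (c # z) = (\<Prod>e\<leftarrow>us @ vs. swap_sign p c e) * koszul p z"
    if "z \<in> shuffles us vs" "distinct (us @ vs)" for c z us vs
  proof -
    have "distinct z" using that by (intro distinct_disjoint_shuffles[OF _ _ _ that(1)]) auto
    have "(\<Prod>e\<leftarrow>z. swap_sign p c e) = (\<Prod>e\<in>set z. swap_sign p c e)"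
      using \<open>distinct z\<close> by (simp add: prod.distinct_set_conv_list)
    also have "set z = set (us @ vs)" using set_shuffles[OF that(1)] by simp
    also have "(\<Prod>e\<in>set (us @ vs). swap_sign p c e) = (\<Prod>e\<leftarrow>us @ vs. swap_sign p c e)"
      using that(2) by (rule prod.distinct_set_conv_list)
    finally show ?thesis by simp
  qed
  let ?f = "\<lambda>c z. f (w ! c # z)"
  have d: "distinct (xs @ b # ys)" "distinct ((a # xs) @ ys)" "a \<noteq> b" using "3.prems" by auto
  have 1: "(\<Sum>z\<in>shuffles xs (b # ys). koszul p (a # z) * f (map ((!) w) (a # z))) =
     koszul p ((a # xs) @ b # ys) * super_shuffle (?f a) (map ((!) w) xs) (map ((!) w) (b # ys))"
  proof -
    have "(\<Sum>z\<in>shuffles xs (b # ys). koszul p (a # z) * f (map ((!) w) (a # z))) =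
      (\<Prod>e\<leftarrow>xs @ b # ys. swap_sign p a e) * (\<Sum>z\<in>shuffles xs (b # ys). koszul p z * ?f a (map ((!) w) z))"
      unfolding sum_distrib_left by (intro sum.cong refl) (simp add: K[OF _ d(1)] del: koszul.simps)
    then show ?thesis unfolding "3.IH"(1)[OF d(1), of "?f a"] by simp
  qed
  have 2: "(\<Sum>z\<in>shuffles (a # xs) ys. koszul p (b # z) * f (map ((!) w) (b # z))) =
     koszul p (b # (a # xs) @ ys) * super_shuffle (?f b) (map ((!) w) (a # xs)) (map ((!) w) ys)"
  proof -
    have "(\<Sum>z\<in>shuffles (a # xs) ys. koszul p (b # z) * f (map ((!) w) (b # z))) =
      (\<Prod>e\<leftarrow>(a # xs) @ ys. swap_sign p b e) * (\<Sum>z\<in>shuffles (a # xs) ys. koszul p z * ?f b (map ((!) w) z))"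
      unfolding sum_distrib_left by (intro sum.cong refl) (simp add: K[OF _ d(2)] del: koszul.simps)
    then show ?thesis unfolding "3.IH"(2)[OF d(2), of "?f b"] by simp
  qed
  let ?e = "(-1) ^ (of_bool (p b) * length (filter p (a # xs))) :: complex"
  have "?e * ?e = 1" by (simp flip: power_mult_distrib)
  then have "koszul p (b # (a # xs) @ ys) = ?e * koszul p ((a # xs) @ b # ys)"
    unfolding koszul_move[OF "3.prems"] by (metis mult.assoc mult_1)
  moreover have "odd_len [w ! b] * odd_len (map ((!) w) (a # xs)) = of_bool (p b) * length (filter p (a # xs))"
    unfolding ol by (simp add: odd_len_def p_def)
  ultimately show ?case
    unfolding sum_shuffles_Cons[OF d(3)] 1 2 by (simp add: distrib_left del: koszul.simps)
qed simp_all

definition place_sign :: "letter list \<Rightarrow> (nat \<Rightarrow> nat) \<Rightarrow> complex" where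
  "place_sign w s = koszul (\<lambda>i. fst (w ! i)) (map s [0..<length w])"

lemma place_sign_prod:
  "place_sign w s = (\<Prod>(j, i)\<in>(SIGMA j:{..<length w}. {..<j}). swap_sign (\<lambda>i. fst (w ! i)) (s i) (s j))"
proof -
  have "place_sign w s = (\<Prod>j<length w. \<Prod>i<j. swap_sign (\<lambda>i. fst (w ! i)) (s i) (s j))"
    unfolding place_sign_def koszul_prod by simp
  then show ?thesis by (simp add: prod.Sigma)
qed

text \<open>The cocycle rule that makes signed place permutations compose. Each pair of positions is
  followed through \<open>t\<close>: if \<open>t\<close> reverses it, the sign of \<open>t\<close>
  corrects for the order in which \<open>s\<close> sees it.\<close>

lemma place_sign_compose:
  assumes s: "s permutes {..<length w}" and t: "t permutes {..<length w}"
  shows "place_sign w (s \<circ> t) = place_sign w s * place_sign (permute_list s w) t"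
proof -
  let ?A = "SIGMA j:{..<length w}. {..<j}"
  let ?p = "\<lambda>i. fst (w ! i)"
  \<comment> \<open>\<open>?m t\<close> sends a pair of positions to the pair of its images, sorted
    again.\<close>
  let ?m = "\<lambda>t (j, i). (max (t j) (t i), min (t j) (t i))"
  have ti: "t i < length w \<longleftrightarrow> i < length w" "inv t i < length w \<longleftrightarrow> i < length w" for i
    using permutes_in_image[OF t] permutes_in_image[OF permutes_inv[OF t]] by simp_all
  have ne: "t j = t i \<longleftrightarrow> j = i" "inv t j = inv t i \<longleftrightarrow> j = i" for i j
    using permutes_inj[OF t] permutes_inj[OF permutes_inv[OF t]] by (auto simp: inj_eq)
  have "place_sign w s = (\<Prod>(j, i)\<in>?A. swap_sign ?p (s (min (t j) (t i))) (s (max (t j) (t i))))"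
    unfolding place_sign_prod
    by (rule prod.reindex_bij_witness[where i = "?m t" and j = "?m (inv t)"])
      (auto simp: ti ne permutes_inverses[OF t] max_def min_def not_le not_less nat_neq_iff intro: le_neq_implies_less split: if_splits)
  moreover have "place_sign (permute_list s w) t =
      (\<Prod>(j, i)\<in>?A. if t j < t i \<and> ?p (s (t i)) \<and> ?p (s (t j)) then -1 else 1)"
    unfolding place_sign_prod
    by (intro prod.cong) (auto simp: swap_sign_def permute_list_nth[OF s] ti)
  ultimately have "place_sign w s * place_sign (permute_list s w) t =
     (\<Prod>(j, i)\<in>?A. swap_sign ?p (s (min (t j) (t i))) (s (max (t j) (t i))) *
        (if t j < t i \<and> ?p (s (t i)) \<and> ?p (s (t j)) then -1 else 1))"
    by (simp add: case_prod_unfold flip: prod.distrib)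
  also have "\<dots> = (\<Prod>(j, i)\<in>?A. swap_sign ?p (s (t i)) (s (t j)))"
  proof (rule prod.cong[OF refl])
    fix x assume "x \<in> ?A"
    then obtain j i where x: "x = (j, i)" "i < j" by blast
    then have "t i \<noteq> t j" "s (t i) \<noteq> s (t j)" using ne permutes_inj[OF s] by (auto simp: inj_eq)
    then show "(case x of (j, i) \<Rightarrow> swap_sign ?p (s (min (t j) (t i))) (s (max (t j) (t i))) *
        (if t j < t i \<and> ?p (s (t i)) \<and> ?p (s (t j)) then -1 else 1)) = (case x of (j, i) \<Rightarrow> swap_sign ?p (s (t i)) (s (t j)))"
      unfolding x by (cases "t i < t j") (auto simp: swap_sign_def min_def max_def)
  qed
  also have "\<dots> = place_sign w (s \<circ> t)" unfolding place_sign_prod by simp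
  finally show ?thesis by simp
qed

lemma permute_list_conv_map: "length w = d \<Longrightarrow> permute_list s w = map ((!) w) (map s [0..<d])"
  by (simp add: permute_list_def)

lemma inv_desc_weight_perm:
  assumes s: "s permutes {..<d}"
  shows "inv_desc_weight q (map s [0..<d]) = desc_weight q (map (inv s) [0..<d])"
proof -
  have lt: "inv s i < d" if "i < d" for i
    using permutes_in_image[OF permutes_inv[OF s], of i] that by simp
  have "before (map s [0..<d]) (Suc i) i \<longleftrightarrow> inv s (Suc i) < inv s i" if "i < d - 1" for i
    using before_nth[of "map s [0..<d]" "inv s (Suc i)" "inv s i"] lt[of i] lt[of "Suc i"] that permutes_inj_on[OF s]
    by (simp add: permutes_inverses[OF s] distinct_map)
  then show ?thesis unfolding inv_desc_weight_def desc_weight_def by (intro prod.cong) auto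
qed

text \<open>Zero on words of any length but \<open>d\<close>, so that the image is homogeneous of
  degree \<open>d\<close>.\<close>

definition klyachko :: "nat \<Rightarrow> complex \<Rightarrow> tensor \<Rightarrow> tensor" where
  "klyachko d q f w = (if length w = d then (1 / of_nat d) *
     (\<Sum>s | s permutes {..<d}. desc_weight q (map (inv s) [0..<d]) * place_sign w s * f (permute_list s w)) else 0)"

locale primitive_root =
  fixes d :: nat and q :: complex
  assumes d_pos: "d > 0" and q_pow_d: "q ^ d = 1"
    and q_pow_neq_1: "0 < k \<Longrightarrow> k < d \<Longrightarrow> q ^ k \<noteq> 1"
begin

text \<open>In terms of positions, \<open>f\<close> becomes a function on orderings that vanishes on
  shuffles, so only the identity survives, with coefficient \<open>d\<close>.\<close>

theorem klyachko_primitive: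
  assumes "primitive f" "\<And>w. f w \<noteq> 0 \<Longrightarrow> length w = d"
  shows "klyachko d q f = f"
proof
  fix w
  show "klyachko d q f w = f w"
  proof (cases "length w = d")
    case True
    let ?F = "\<lambda>z. koszul (\<lambda>i. fst (w ! i)) z * f (map ((!) w) z)"
    have "(\<Sum>s | s permutes {..<d}. desc_weight q (map (inv s) [0..<d]) * place_sign w s * f (permute_list s w)) =
      (\<Sum>s | s permutes {..<d}. inv_desc_weight q (map s [0..<d]) * ?F (map s [0..<d]))"
      using True by (intro sum.cong) (simp_all add: inv_desc_weight_perm place_sign_def permute_list_conv_map[OF True])
    also have "\<dots> = (\<Sum>z\<in>orderings d. inv_desc_weight q z * ?F z)"
      by (rule sum.reindex_bij_betw[OF bij_betw_orderings])
    also have "\<dots> = (\<Prod>i<d - 1. 1 - q ^ Suc i) * ?F [0..<d]"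
    proof (rule sum_orderings_inv_desc_weight)
      fix xs ys assume "xs @ ys \<in> orderings d" "xs \<noteq> []" "ys \<noteq> []"
      then show "(\<Sum>z\<in>shuffles xs ys. ?F z) = 0"
        using sum_shuffles_koszul[of xs ys w f] assms(1) by (simp add: orderings_def primitive_def)
    qed
    also have "(\<Prod>i<d - 1. 1 - q ^ Suc i) = of_nat d"
      by (rule prod_one_minus_primitive_root) (use d_pos q_pow_d q_pow_neq_1 in auto)
    also have "?F [0..<d] = f w"
      using True by (auto simp: koszul_upt map_nth)
    finally show ?thesis using True d_pos by (simp add: klyachko_def)
  qed (use assms(2)[of w] in \<open>auto simp: klyachko_def\<close>)
qed

text \<open>The super shuffle is expanded over the permutations that shuffle the positions of the
  two words. Each resulting coefficient is a sum of major index powers over shuffles, which is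
  zero.\<close>

theorem primitive_klyachko: "primitive (klyachko d q f)"
  unfolding primitive_def
proof (intro conjI allI impI)
  show "klyachko d q f [] = 0" using d_pos by (simp add: klyachko_def)
next
  fix u v :: "letter list" assume uv: "u \<noteq> []" "v \<noteq> []"
  show "super_shuffle (klyachko d q f) u v = 0"
  proof (cases "length u + length v = d")
    case False
    have "super_shuffle (klyachko d q f) u v = super_shuffle (\<lambda>_. 0) u v"
      using False by (intro super_shuffle_cong) (simp add: klyachko_def)
    then show ?thesis by simp
  next
    case True
    define w where "w = u @ v"
    define xs where "xs = [0..<length u]"
    define ys where "ys = [length u..<d]"
    have w: "length w = d" using True by (simp add: w_def)
    have xy: "xs @ ys = [0..<d]" using True upt_add_eq_append[of 0 "length u" "length v"] by (simp add: xs_def ys_def)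
    have u: "map ((!) w) xs = u" and v: "map ((!) w) ys = v"
      using True by (auto simp: w_def xs_def ys_def nth_append intro!: nth_equalityI)
    let ?S = "{s. s permutes {..<d}}"
    define Sh where "Sh = {s \<in> ?S. map s [0..<d] \<in> shuffles xs ys}"
    have fS: "finite ?S" by (rule finite_permutations) simp
    have sub: "shuffles xs ys \<subseteq> orderings d"
    proof
      fix z assume z: "z \<in> shuffles xs ys"
      have "distinct z" using z by (intro distinct_disjoint_shuffles[OF _ _ _ z]) (auto simp: xs_def ys_def)
      then show "z \<in> orderings d" using set_shuffles[OF z] True by (auto simp: orderings_def xs_def ys_def)
    qed
    have bij: "bij_betw (\<lambda>s. map s [0..<d]) Sh (shuffles xs ys)"
      using bij_betw_orderings[of d] sub unfolding bij_betw_def Sh_def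
      by (auto simp: inj_on_def)
    let ?k = "\<lambda>s. desc_weight q (map (inv s) [0..<d])"
    have perm: "s permutes {..<length w}" if "s \<in> ?S" for s using that w by simp
    have "super_shuffle (klyachko d q f) u v =
        koszul (\<lambda>i. fst (w ! i)) (xs @ ys) * super_shuffle (klyachko d q f) (map ((!) w) xs) (map ((!) w) ys)"
      unfolding u v xy koszul_upt by simp
    also have "\<dots> = (\<Sum>z\<in>shuffles xs ys. koszul (\<lambda>i. fst (w ! i)) z * klyachko d q f (map ((!) w) z))"
      by (rule sum_shuffles_koszul[symmetric]) (simp add: xy)
    also have "\<dots> = (\<Sum>s\<in>Sh. place_sign w s * klyachko d q f (permute_list s w))"
      by (subst sum.reindex_bij_betw[OF bij, symmetric]) (simp add: place_sign_def permute_list_conv_map[OF w] w)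
    also have "\<dots> = (\<Sum>s\<in>Sh. (1 / of_nat d) * (\<Sum>r\<in>?S. ?k r * (place_sign w (s \<circ> r) * f (permute_list (s \<circ> r) w))))"
      by (intro sum.cong refl)
        (simp add: klyachko_def w place_sign_compose perm permute_list_compose sum_distrib_left mult.assoc mult.left_commute Sh_def)
    \<comment> \<open>The substitution \<open>t = s \<circ> r\<close> collects the coefficient of
      each word \<open>permute_list t w\<close>.\<close>
    also have "\<dots> = (\<Sum>s\<in>Sh. (1 / of_nat d) * (\<Sum>t\<in>?S. ?k (inv s \<circ> t) * (place_sign w t * f (permute_list t w))))"
    proof (intro sum.cong refl)
      fix s assume "s \<in> Sh"
      then have s: "s permutes {..<d}" by (simp add: Sh_def)
      show "(1 / of_nat d) * (\<Sum>r\<in>?S. ?k r * (place_sign w (s \<circ> r) * f (permute_list (s \<circ> r) w))) =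
         (1 / of_nat d) * (\<Sum>t\<in>?S. ?k (inv s \<circ> t) * (place_sign w t * f (permute_list t w)))"
        unfolding setum_permutations_compose_left[OF s, of "\<lambda>t. ?k (inv s \<circ> t) * (place_sign w t * f (permute_list t w))"]
        by (simp add: permutes_inv_o[OF s] flip: comp_assoc)
    qed
    also have "\<dots> = (\<Sum>t\<in>?S. (1 / of_nat d) * (\<Sum>s\<in>Sh. ?k (inv s \<circ> t)) * (place_sign w t * f (permute_list t w)))"
      unfolding sum_distrib_left sum_distrib_right
      by (subst sum.swap) (simp add: mult.assoc)
    also have "\<dots> = (\<Sum>t\<in>?S. 0)"
    proof (intro sum.cong refl)
      fix t assume "t \<in> ?S"
      then have t: "t permutes {..<d}" by simp
      let ?t = "inv t"
      have inj: "inj ?t" using permutes_inj[OF permutes_inv[OF t]] .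
      \<comment> \<open>The inverse of \<open>inv s \<circ> t\<close> is
        \<open>inv t \<circ> s\<close>, whose one-line notation is that of \<open>s\<close>
        relabelled by \<open>inv t\<close>; these run through the shuffles of the relabelled
        words.\<close>
      have "(\<Sum>s\<in>Sh. ?k (inv s \<circ> t)) = (\<Sum>s\<in>Sh. desc_weight q (map ?t (map s [0..<d])))"
      proof (intro sum.cong refl)
        fix s assume "s \<in> Sh"
        then have s: "s permutes {..<d}" by (simp add: Sh_def)
        have "inv (inv s \<circ> t) = ?t \<circ> s"
          using o_inv_distrib[OF permutes_bij[OF permutes_inv[OF s]] permutes_bij[OF t]] permutes_inv_inv[OF s] by simp
        then show "?k (inv s \<circ> t) = desc_weight q (map ?t (map s [0..<d]))" by simp
      qed
      also have "\<dots> = (\<Sum>z\<in>shuffles xs ys. desc_weight q (map ?t z))"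
        by (rule sum.reindex_bij_betw[OF bij])
      also have "\<dots> = (\<Sum>z\<in>shuffles (map ?t xs) (map ?t ys). desc_weight q z)"
        unfolding map_shuffles[symmetric] using inj by (subst sum.reindex) (auto simp: inj_on_def inj_map_eq_map)
      also have "\<dots> = 0"
      proof (rule sum_shuffles_desc_weight)
        show "distinct (map ?t xs @ map ?t ys)"
          unfolding map_append[symmetric] xy using inj by (simp add: distinct_map inj_on_subset[OF _ subset_UNIV])
        have l: "length (map ?t xs) + length (map ?t ys) = d" using True by (simp add: xs_def ys_def)
        show "q ^ (length (map ?t xs) + length (map ?t ys)) = 1" unfolding l by (rule q_pow_d)
        show "q ^ k \<noteq> 1" if "0 < k" "k < length (map ?t xs) + length (map ?t ys)" for k
          using that unfolding l by (rule q_pow_neq_1)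
      qed (use uv True in \<open>auto simp: xs_def ys_def\<close>)
      finally show "(1 / of_nat d) * (\<Sum>s\<in>Sh. ?k (inv s \<circ> t)) * (place_sign w t * f (permute_list t w)) = 0" by simp
    qed
    finally show ?thesis by simp
  qed
qed

end

section \<open>The character as a trace over permutations\<close>

text \<open>The trace of \<open>T\<close> on the image of a projection \<open>P\<close> is the trace
  of \<open>T\<close> after \<open>P\<close> on the whole space, read off in the basis of words.
  \<open>P\<close> enters only through its values on words.\<close>

lemma trace_on_projection:
  assumes W: "finite W" and L: "tens.subspace L" and LW: "\<And>f w. f \<in> L \<Longrightarrow> f w \<noteq> 0 \<Longrightarrow> w \<in> W"
    and P: "\<And>w. w \<in> W \<Longrightarrow> P (unit_tensor w) \<in> L"
    and Pf: "\<And>f. f \<in> L \<Longrightarrow> (\<Sum>w\<in>W. tscale (f w) (P (unit_tensor w))) = f"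
    and T: "\<And>f. f \<in> L \<Longrightarrow> T f \<in> L"
    and lin: "\<And>f g. T (f + g) = T f + T g" "\<And>c f. T (tscale c f) = tscale c (T f)"
  shows "trace_on L T = (\<Sum>w\<in>W. T (P (unit_tensor w)) w)"
proof -
  have fL: "f = (\<Sum>w\<in>W. tscale (f w) (unit_tensor w))" if "f \<in> L" for f
  proof
    fix z
    show "f z = (\<Sum>w\<in>W. tscale (f w) (unit_tensor w)) z"
      using LW[OF that, of z] W by (cases "z \<in> W")
        (auto simp: fun_sum_apply tscale_def unit_tensor_def of_bool_def if_distrib cong: if_cong)
  qed
  define Bs where "Bs = (SOME B. finite B \<and> \<not> module.dependent tscale B \<and> module.span tscale B = L)"
  \<comment> \<open>A finite basis exists, so the choice in \<open>trace_on\<close> does pick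
    one.\<close>
  have "\<exists>B. finite B \<and> \<not> tens.dependent B \<and> tens.span B = L"
  proof -
    obtain B where B: "B \<subseteq> L" "\<not> tens.dependent B" "L \<subseteq> tens.span B"
      using tens.maximal_independent_subset by blast
    have "L \<subseteq> tens.span (unit_tensor ` W)"
    proof
      fix f assume "f \<in> L"
      then have "f = (\<Sum>w\<in>W. tscale (f w) (unit_tensor w))" by (rule fL)
      also have "\<dots> \<in> tens.span (unit_tensor ` W)"
        by (intro tens.span_sum tens.span_scale tens.span_base) auto
      finally show "f \<in> tens.span (unit_tensor ` W)" .
    qed
    then have "finite B" using tens.independent_span_bound[OF _ B(2), of "unit_tensor ` W"] W B(1) by blast
    moreover have "tens.span B = L"
      using tens.span_minimal[OF B(1) L] B(3) by blast
    ultimately show ?thesis using B(2) by blast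
  qed
  then have "finite Bs \<and> \<not> tens.dependent Bs \<and> tens.span Bs = L" unfolding Bs_def by (rule someI_ex)
  then have B: "finite Bs" "\<not> tens.dependent Bs" "tens.span Bs = L" by auto
  let ?r = "tens.representation Bs"
  have BL: "b \<in> L" if "b \<in> Bs" for b using tens.span_base[OF that] B(3) by simp
  have "T 0 = 0"
    using lin(2)[of 0 0] unfolding tens.scale_zero_left .
  then have Tsum: "T (sum F A) = (\<Sum>a\<in>A. T (F a))" for F :: "tensor \<Rightarrow> tensor" and A
    by (induction A rule: infinite_finite_induct) (simp_all only: sum.infinite sum.empty sum.insert lin not_False_eq_True)
  have TP: "T (P (unit_tensor w)) w = (\<Sum>b\<in>Bs. ?r (P (unit_tensor w)) b * T b w)" if "w \<in> W" for w
  proof -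
    have "P (unit_tensor w) = (\<Sum>b\<in>Bs. tscale (?r (P (unit_tensor w)) b) b)"
      using tens.sum_representation_eq[OF B(2), of "P (unit_tensor w)" Bs] P[OF that] B by simp
    then have "T (P (unit_tensor w)) = (\<Sum>b\<in>Bs. tscale (?r (P (unit_tensor w)) b) (T b))"
      using Tsum[of "\<lambda>b. tscale (?r (P (unit_tensor w)) b) b" Bs] by (simp add: lin)
    then show ?thesis by (simp add: fun_sum_apply tscale_def)
  qed
  have "(\<Sum>w\<in>W. T (P (unit_tensor w)) w) = (\<Sum>w\<in>W. \<Sum>b\<in>Bs. ?r (P (unit_tensor w)) b * T b w)"
    using TP by simp
  also have "\<dots> = (\<Sum>b\<in>Bs. \<Sum>w\<in>W. T b w * ?r (P (unit_tensor w)) b)"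
    by (subst sum.swap) (simp add: mult.commute)
  \<comment> \<open>\<open>T b\<close> lies in \<open>L\<close>, hence is fixed by the projection:
    its expansion in words can be replaced by the same expansion in the images of the words.\<close>
  also have "\<dots> = (\<Sum>b\<in>Bs. ?r (T b) b)"
  proof (intro sum.cong refl)
    fix b assume "b \<in> Bs"
    then have Tb: "T b \<in> L" using BL T by blast
    have "?r (T b) = ?r (\<Sum>w\<in>W. tscale (T b w) (P (unit_tensor w)))" using Pf[OF Tb] by simp
    also have "\<dots> = (\<lambda>b'. \<Sum>w\<in>W. ?r (tscale (T b w) (P (unit_tensor w))) b')"
      using P B(3) by (intro tens.representation_sum[OF B(2)] tens.span_scale) simp
    also have "\<dots> = (\<lambda>b'. \<Sum>w\<in>W. T b w * ?r (P (unit_tensor w)) b')"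
      using P B(3) by (intro ext sum.cong refl) (simp add: tens.representation_scale[OF B(2)])
    finally show "(\<Sum>w\<in>W. T b w * ?r (P (unit_tensor w)) b) = ?r (T b) b" by simp
  qed
  also have "\<dots> = trace_on L T" unfolding trace_on_def Let_def Bs_def ..
  finally show ?thesis ..
qed

section \<open>Lie elements of a fixed bidegree and their trace\<close>

definition bideg_words :: "nat \<Rightarrow> nat \<Rightarrow> nat \<Rightarrow> letter list set" where
  "bideg_words N n m = {w. length (filter (\<lambda>a. \<not> fst a) w) = n \<and> length (filter fst w) = m \<and> (\<forall>a\<in>set w. snd a < N)}"

lemma length_bideg_words: "w \<in> bideg_words N n m \<Longrightarrow> length w = n + m"
  using sum_length_filter_compl[of fst w] by (simp add: bideg_words_def)

lemma finite_bideg_words: "finite (bideg_words N n m)"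
proof (rule finite_subset)
  show "bideg_words N n m \<subseteq> {w. set w \<subseteq> (UNIV :: bool set) \<times> {..<N} \<and> length w = n + m}"
    using length_bideg_words by (fastforce simp: bideg_words_def)
qed (intro finite_lists_length_eq finite_cartesian_product, simp_all)

lemma permute_bideg_words:
  assumes "s permutes {..<length w}"
  shows "permute_list s w \<in> bideg_words N n m \<longleftrightarrow> w \<in> bideg_words N n m"
proof -
  have "length (filter Q (permute_list s w)) = length (filter Q w)" for Q
    using assms by (metis mset_filter mset_permute_list size_mset)
  then show ?thesis using assms by (simp add: bideg_words_def)
qed

lemma diag_act_linear:
  "diag_act x (f + g) = diag_act x f + diag_act x g" "diag_act x (tscale c f) = tscale c (diag_act x f)"
  by (auto simp: diag_act_def tscale_def algebra_simps)

text \<open>Friedrichs' criterion in one bidegree: brackets are primitive, and conversely the Dynkin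
  operator applies since the degree is positive.\<close>

lemma lie_part_iff:
  assumes "n + m > 0"
  shows "f \<in> lie_part N n m \<longleftrightarrow> primitive f \<and> (\<forall>w. f w \<noteq> 0 \<longrightarrow> w \<in> bideg_words N n m)"
proof
  assume "f \<in> lie_part N n m"
  then have "f \<in> free_lie_super N" "f \<in> bideg n m" by (auto simp: lie_part_def)
  then show "primitive f \<and> (\<forall>w. f w \<noteq> 0 \<longrightarrow> w \<in> bideg_words N n m)"
    using free_lie_super_props[of f N] unfolding letters_below_def bideg_def bideg_words_def by blast
next
  assume f: "primitive f \<and> (\<forall>w. f w \<noteq> 0 \<longrightarrow> w \<in> bideg_words N n m)"
  have "f \<in> free_lie_super N"
  proof (rule primitive_in_free_lie_super)
    show "f \<in> letters_below N" using f unfolding letters_below_def bideg_words_def by blast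
    show "length w = n + m" if "f w \<noteq> 0" for w using that f length_bideg_words by blast
  qed (use f assms in auto)
  moreover have "f \<in> bideg n m" using f unfolding bideg_def bideg_words_def by blast
  ultimately show "f \<in> lie_part N n m" by (simp add: lie_part_def)
qed

text \<open>All shuffles of \<open>u\<close> and \<open>v\<close> have the same letters, so the
  weight is a common factor.\<close>

lemma super_shuffle_diag_act:
  "super_shuffle (diag_act x f) u v =
     prod_list (map (\<lambda>a. x (snd a)) u) * prod_list (map (\<lambda>a. x (snd a)) v) * super_shuffle f u v"
proof (induction f u v rule: super_shuffle.induct)
  case (3 f a u b v)
  have *: "(\<lambda>z. diag_act x f (c # z)) = (\<lambda>z. x (snd c) * diag_act x (\<lambda>z. f (c # z)) z)" for c
    by (simp add: diag_act_def mult.assoc)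
  show ?case unfolding super_shuffle.simps * super_shuffle_scale "3.IH"
    by (simp add: algebra_simps)
qed (simp_all add: diag_act_def)

lemma primitive_diag_act: "primitive f \<Longrightarrow> primitive (diag_act x f)"
  by (simp add: primitive_def super_shuffle_diag_act) (simp add: diag_act_def)

context primitive_root begin

lemma klyachko_sum:
  assumes "finite W" "\<And>w. w \<notin> W \<Longrightarrow> f w = 0"
  shows "(\<Sum>w\<in>W. tscale (f w) (klyachko d q (unit_tensor w))) = klyachko d q f"
proof
  fix z
  have f: "f y = (\<Sum>w\<in>W. f w * unit_tensor w y)" for y
    using assms by (cases "y \<in> W") (auto simp: unit_tensor_def of_bool_def if_distrib cong: if_cong)
  show "(\<Sum>w\<in>W. tscale (f w) (klyachko d q (unit_tensor w))) z = klyachko d q f z"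
  proof (cases "length z = d")
    case True
    let ?c = "\<lambda>s. desc_weight q (map (inv s) [0..<d]) * place_sign z s"
    have "klyachko d q f z = (1 / of_nat d) * (\<Sum>s | s permutes {..<d}. ?c s * (\<Sum>w\<in>W. f w * unit_tensor w (permute_list s z)))"
      unfolding klyachko_def f[symmetric] using True by simp
    also have "\<dots> = (\<Sum>w\<in>W. f w * ((1 / of_nat d) * (\<Sum>s | s permutes {..<d}. ?c s * unit_tensor w (permute_list s z))))"
      unfolding sum_distrib_left by (subst sum.swap) (simp add: mult.assoc mult.left_commute)
    finally show ?thesis using True by (simp add: fun_sum_apply tscale_def klyachko_def)
  qed (simp add: fun_sum_apply tscale_def klyachko_def)
qed

text \<open>Klyachko's operator is a projection onto the Lie elements, so the character is its
  weighted trace; a permutation contributes to the diagonal entry at a word only if it fixes the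
  word.\<close>

lemma lie_char_eq_sum_permutations:
  assumes nm: "n + m = d"
  shows "lie_char N n m x = (1 / of_nat d) * (\<Sum>s | s permutes {..<d}. desc_weight q (map (inv s) [0..<d]) *
     (\<Sum>w | w \<in> bideg_words N n m \<and> permute_list s w = w. place_sign w s * prod_list (map (\<lambda>a. x (snd a)) w)))"
proof -
  let ?W = "bideg_words N n m" and ?L = "lie_part N n m"
  have pos: "n + m > 0" using nm d_pos by simp
  note iff = lie_part_iff[OF pos]
  have kL: "klyachko d q f \<in> ?L" if "\<And>w. w \<notin> ?W \<Longrightarrow> f w = 0" for f
    unfolding iff
  proof (intro conjI allI impI)
    fix w assume nz: "klyachko d q f w \<noteq> 0"
    then have l: "length w = d" by (auto simp: klyachko_def split: if_splits)
    show "w \<in> ?W"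
    proof (rule ccontr)
      assume "w \<notin> ?W"
      then have "f (permute_list s w) = 0" if "s permutes {..<d}" for s
        using that \<open>\<And>w. w \<notin> ?W \<Longrightarrow> f w = 0\<close> permute_bideg_words[of s w] l by blast
      then have "klyachko d q f w = 0" by (simp add: klyachko_def)
      with nz show False by simp
    qed
  qed (rule primitive_klyachko)
  have "lie_char N n m x = (\<Sum>w\<in>?W. diag_act x (klyachko d q (unit_tensor w)) w)"
    unfolding lie_char_def
  proof (rule trace_on_projection)
    show "finite ?W" by (rule finite_bideg_words)
    show "tens.subspace ?L"
    proof (rule tens.subspaceI)
      show "0 \<in> ?L" by (simp add: iff primitive_def zero_fun_def)
      show "f + g \<in> ?L" if "f \<in> ?L" "g \<in> ?L" for f g
      proof -
        have "primitive (f + g)"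
          using that unfolding iff primitive_def plus_fun_def super_shuffle_add by simp
        moreover have "(f + g) w \<noteq> 0 \<Longrightarrow> f w \<noteq> 0 \<or> g w \<noteq> 0" for w by auto
        ultimately show ?thesis using that unfolding iff by blast
      qed
      show "tscale c f \<in> ?L" if "f \<in> ?L" for c f
      proof -
        have "primitive (tscale c f)"
          using that unfolding iff primitive_def tscale_def super_shuffle_scale by simp
        moreover have "tscale c f w \<noteq> 0 \<Longrightarrow> f w \<noteq> 0" for w by (auto simp: tscale_def)
        ultimately show ?thesis using that unfolding iff by blast
      qed
    qed
    show "w \<in> ?W" if "f \<in> ?L" "f w \<noteq> 0" for f w using that by (simp add: iff)
    show "klyachko d q (unit_tensor w) \<in> ?L" if "w \<in> ?W" for w
      using that by (intro kL) (auto simp: unit_tensor_def)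
    show "(\<Sum>w\<in>?W. tscale (f w) (klyachko d q (unit_tensor w))) = f" if "f \<in> ?L" for f
    proof -
      have "(\<Sum>w\<in>?W. tscale (f w) (klyachko d q (unit_tensor w))) = klyachko d q f"
        using that by (intro klyachko_sum finite_bideg_words) (auto simp: iff)
      also have "\<dots> = f"
        using that length_bideg_words nm by (intro klyachko_primitive) (auto simp: iff)
      finally show ?thesis .
    qed
    show "diag_act x f \<in> ?L" if "f \<in> ?L" for f
      using that by (auto simp: iff primitive_diag_act) (simp add: diag_act_def)
  qed (rule diag_act_linear)+
  also have "\<dots> = (\<Sum>w\<in>?W. (1 / of_nat d) * (\<Sum>s | s permutes {..<d}. desc_weight q (map (inv s) [0..<d]) *
      (if permute_list s w = w then place_sign w s * prod_list (map (\<lambda>a. x (snd a)) w) else 0)))"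
    unfolding diag_act_def klyachko_def
    using length_bideg_words nm
    by (intro sum.cong refl) (auto simp: unit_tensor_def sum_distrib_left intro!: sum.cong)
  also have "\<dots> = (1 / of_nat d) * (\<Sum>s | s permutes {..<d}. desc_weight q (map (inv s) [0..<d]) *
      (\<Sum>w\<in>?W. if permute_list s w = w then place_sign w s * prod_list (map (\<lambda>a. x (snd a)) w) else 0))"
    unfolding sum_distrib_left by (subst sum.swap) (rule refl)
  finally show ?thesis by (simp add: sum.inter_filter[OF finite_bideg_words])
qed

end

section \<open>Rotations\<close>

lemma rot_eq: "i < d \<Longrightarrow> rot d i = (if Suc i = d then 0 else Suc i)"
  by (simp add: rot_def)

lemma rot_less: "i < d \<Longrightarrow> rot d i < d"
  by (auto simp: rot_eq)

lemma rot_permutes: "rot d permutes {..<d}"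
proof (rule bij_imp_permutes)
  have "inj_on (rot d) {..<d}"
    by (auto simp: inj_on_def rot_eq split: if_splits)
  moreover have "rot d ` {..<d} \<subseteq> {..<d}" using rot_less by auto
  ultimately show "bij_betw (rot d) {..<d} {..<d}"
    by (simp add: bij_betw_def endo_inj_surj)
qed (simp add: rot_def)

lemma rot_pow_permutes: "rot d ^^ k permutes {..<d}"
proof (induction k)
  case (Suc k)
  then show ?case using permutes_compose[OF Suc rot_permutes] by (simp only: funpow.simps)
qed (simp only: funpow.simps permutes_id)

lemma rot_pow: "i < d \<Longrightarrow> (rot d ^^ k) i = (i + k) mod d"
proof (induction k)
  case (Suc k)
  then show ?case by (simp add: rot_def mod_Suc_eq)
qed simp

lemma rot_pow_inj: "inj_on (\<lambda>k. rot d ^^ k) {..<d}"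
proof (rule inj_onI)
  fix j k assume jk: "j \<in> {..<d}" "k \<in> {..<d}" "rot d ^^ j = rot d ^^ k"
  then have "0 < d" by auto
  have "(0 + j) mod d = (0 + k) mod d"
    unfolding rot_pow[OF \<open>0 < d\<close>, symmetric] jk(3) ..
  then show "j = k" using jk(1,2) by simp
qed

section \<open>Cyclic descents\<close>

definition cyclic_descents :: "nat \<Rightarrow> (nat \<Rightarrow> nat) \<Rightarrow> nat" where
  "cyclic_descents d t = card {i. i < d \<and> t i > t (rot d i)}"

lemma cyclic_descents_rot: "cyclic_descents d (t \<circ> rot d) = cyclic_descents d t"
proof -
  have "bij_betw (rot d) {i. i < d \<and> t (rot d i) > t (rot d (rot d i))} {i. i < d \<and> t i > t (rot d i)}"
    unfolding bij_betw_def
  proof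
    show "inj_on (rot d) {i. i < d \<and> t (rot d i) > t (rot d (rot d i))}"
      using permutes_inj_on[OF rot_permutes] .
    show "rot d ` {i. i < d \<and> t (rot d i) > t (rot d (rot d i))} = {i. i < d \<and> t i > t (rot d i)}"
    proof
      show "{i. i < d \<and> t i > t (rot d i)} \<subseteq> rot d ` {i. i < d \<and> t (rot d i) > t (rot d (rot d i))}"
      proof
        fix i assume i: "i \<in> {i. i < d \<and> t i > t (rot d i)}"
        then have "inv (rot d) i < d" using permutes_in_image[OF permutes_inv[OF rot_permutes[of d]], of i] by simp
        moreover have "rot d (inv (rot d) i) = i" using permutes_inverses(1)[OF rot_permutes] .
        ultimately show "i \<in> rot d ` {i. i < d \<and> t (rot d i) > t (rot d (rot d i))}"
          using i by (intro image_eqI[of _ _ "inv (rot d) i"]) auto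
      qed
    qed (auto simp: rot_less)
  qed
  then show ?thesis unfolding cyclic_descents_def by (simp add: bij_betw_same_card)
qed

lemma cyclic_descents_rot_pow: "cyclic_descents d (t \<circ> (rot d ^^ k)) = cyclic_descents d t"
proof (induction k)
  case (Suc k)
  have "t \<circ> (rot d ^^ Suc k) = t \<circ> (rot d ^^ k) \<circ> rot d"
    by (simp only: funpow_Suc_right comp_assoc)
  then show ?case using Suc by (simp only: cyclic_descents_rot)
qed simp

lemma cyclic_descents_less: "t permutes {..<d} \<Longrightarrow> d > 0 \<Longrightarrow> cyclic_descents d t < d"
proof -
  assume t: "t permutes {..<d}" and d: "d > 0"
  have i: "inv t 0 < d" using permutes_in_image[OF permutes_inv[OF t], of 0] d by simp
  \<comment> \<open>The position \<open>inv t 0\<close> of the least value is never a cyclic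
    descent.\<close>
  have "{i. i < d \<and> t i > t (rot d i)} \<subseteq> {..<d} - {inv t 0}"
  proof
    fix j assume j: "j \<in> {i. i < d \<and> t i > t (rot d i)}"
    then have "t j \<noteq> t (inv t 0)" unfolding permutes_inverses(1)[OF t] by simp
    then show "j \<in> {..<d} - {inv t 0}" using j by auto
  qed
  then have "card {i. i < d \<and> t i > t (rot d i)} \<le> card ({..<d} - {inv t 0})"
    by (intro card_mono) simp_all
  also have "\<dots> < d" using i d by simp
  finally show ?thesis unfolding cyclic_descents_def .
qed

text \<open>The sole cyclic descent wraps around from \<open>d - 1\<close> to 0; for
  \<open>d = 1\<close> there is none.\<close>

lemma cyclic_descents_id: "cyclic_descents d id = (if d < 2 then 0 else 1)"
proof -
  have "{i. i < d \<and> id i > id (rot d i)} = (if d < 2 then {} else {d - 1})"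
    by (auto simp: rot_eq split: if_splits)
  then show ?thesis by (simp add: cyclic_descents_def)
qed

text \<open>As \<open>t 0 = 0\<close>, the wrap-around at \<open>d - 1\<close> is the one cyclic
  descent, so \<open>t\<close> increases everywhere else.\<close>

lemma cyclic_descents_1_imp_id:
  assumes t: "t permutes {..<d}" "t 0 = 0" "d \<ge> 2" "cyclic_descents d t = 1"
  shows "t = id"
proof -
  obtain a where a: "{i. i < d \<and> t i > t (rot d i)} = {a}"
    using t(4) by (auto simp: cyclic_descents_def card_1_singleton_iff)
  have "t (d - 1) \<noteq> t 0" using permutes_inj[OF t(1)] t(3) by (simp add: inj_eq)
  then have "d - 1 \<in> {i. i < d \<and> t i > t (rot d i)}" using t(2,3) by (simp add: rot_eq)
  then have da: "d - 1 = a" unfolding a by simp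
  have "t i < t (Suc i)" if "i < d - 1" for i
  proof -
    have "i \<notin> {i. i < d \<and> t i > t (rot d i)}" using that da unfolding a by simp
    moreover have "t i \<noteq> t (Suc i)" using permutes_inj[OF t(1)] by (simp add: inj_eq)
    moreover have "i < d" "Suc i \<noteq> d" using that by auto
    ultimately show ?thesis by (simp add: rot_eq)
  qed
  then have "sorted_wrt (<) (map t [0..<d])"
    by (simp add: sorted_wrt_iff_nth_Suc_transp[OF transp_on_less])
  moreover have "map t [0..<d] \<in> orderings d"
    using bij_betw_orderings[of d] t(1) unfolding bij_betw_def by blast
  ultimately have "map t [0..<d] = [0..<d]"
    by (intro sorted_distinct_set_unique) (auto simp: orderings_def strict_sorted_iff)
  then have "t i = i" if "i < d" for i using that by (metis add_0 diff_zero length_upt nth_map nth_upt)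
  moreover have "t i = i" if "\<not> i < d" for i using t(1) that by (simp add: permutes_def)
  ultimately show ?thesis by (metis eq_id_iff)
qed

section \<open>The major index under rotations\<close>

context primitive_root begin

abbreviation (input) maj_weight :: "(nat \<Rightarrow> nat) \<Rightarrow> complex" where
  "maj_weight t \<equiv> desc_weight q (map t [0..<d])"

text \<open>A wrap-around descent has weight \<open>q ^ d = 1\<close>, so the weight can be taken
  over all cyclic descents.\<close>

lemma maj_weight_cyclic:
  "maj_weight t = (\<Prod>i<d. if t i > t (rot d i) then q ^ Suc i else 1)"
proof -
  have "(\<Prod>i<Suc (d - 1). if t i > t (rot d i) then q ^ Suc i else 1) =
     (\<Prod>i<d - 1. if t i > t (rot d i) then q ^ Suc i else 1)"
    unfolding prod.lessThan_Suc using q_pow_d d_pos by (simp del: power_Suc)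
  also have "\<dots> = maj_weight t"
    unfolding desc_weight_def by (intro prod.cong) (auto simp: rot_eq)
  finally show ?thesis using d_pos by simp
qed

lemma q_pow_Suc_rot: "i < d \<Longrightarrow> q ^ Suc (rot d i) = q * q ^ Suc i"
proof (cases "Suc i = d")
  case True
  then show ?thesis using q_pow_d unfolding True by (simp add: rot_def True[symmetric])
qed (simp add: rot_eq)

text \<open>Rotating the positions moves each cyclic descent by one place, which changes its weight
  by a factor \<open>q\<close>.\<close>

lemma maj_weight_rot_right: "maj_weight t = q ^ cyclic_descents d t * maj_weight (t \<circ> rot d)"
proof -
  have "maj_weight t = (\<Prod>i<d. if t (rot d i) > t (rot d (rot d i)) then q ^ Suc (rot d i) else 1)"
    unfolding maj_weight_cyclic
    by (rule prod.reindex_bij_betw[OF permutes_imp_bij[OF rot_permutes], symmetric])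
  also have "\<dots> = (\<Prod>i<d. (if t (rot d i) > t (rot d (rot d i)) then q else 1) *
      (if (t \<circ> rot d) i > (t \<circ> rot d) (rot d i) then q ^ Suc i else 1))"
    by (intro prod.cong) (auto simp: q_pow_Suc_rot simp del: power_Suc)
  also have "\<dots> = (\<Prod>i<d. if (t \<circ> rot d) i > (t \<circ> rot d) (rot d i) then q else 1) * maj_weight (t \<circ> rot d)"
    unfolding prod.distrib maj_weight_cyclic by simp
  also have "(\<Prod>i<d. if (t \<circ> rot d) i > (t \<circ> rot d) (rot d i) then q else 1) = q ^ cyclic_descents d (t \<circ> rot d)"
    unfolding cyclic_descents_def by (simp add: prod.If_cases Int_def)
  finally show ?thesis by (simp only: cyclic_descents_rot)
qed

text \<open>Adding 1 modulo \<open>d\<close> to the values turns the greatest value into the least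
  and leaves the other comparisons unchanged: the cyclic descent at its position \<open>p\<close>
  moves to the preceding position \<open>p'\<close>.\<close>

lemma maj_weight_rot_left:
  assumes t: "t permutes {..<d}"
  shows "q * maj_weight (rot d \<circ> t) = maj_weight t"
\<comment> \<open>For \<open>d = 1\<close> the positions \<open>p\<close> and \<open>p'\<close>
  would coincide.\<close>
proof (cases "d = 1")
  case True
  then show ?thesis using q_pow_d by (simp add: desc_weight_def)
next
  case False
  then have d2: "d \<ge> 2" using d_pos by simp
  define p where "p = inv t (d - 1)"
  define p' where "p' = inv (rot d) p"
  have tp: "t p = d - 1" by (simp add: p_def permutes_inverses[OF t])
  have p: "p < d" using permutes_in_image[OF permutes_inv[OF t], of "d - 1"] d_pos by (simp add: p_def)
  have rp': "rot d p' = p" by (simp add: p'_def permutes_inverses[OF rot_permutes])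
  have p': "p' < d" using permutes_in_image[OF permutes_inv[OF rot_permutes[of d]], of p] p by (simp add: p'_def)
  have rne: "rot d i \<noteq> i" if "i < d" for i using that d2 by (auto simp: rot_eq)
  have ne: "p \<noteq> p'" using rne[OF p'] rp' by auto
  have tl: "t i < d" if "i < d" for i using permutes_in_image[OF t, of i] that by simp
  have tlt: "t i < d - 1" if "i < d" "i \<noteq> p" for i
  proof -
    have "t i \<noteq> t p" using that permutes_inj[OF t] by (simp add: inj_eq)
    then show ?thesis using tl[OF that(1)] tp by simp
  qed
  have rt: "rot d (t i) = (if i = p then 0 else Suc (t i))" if "i < d" for i
    using tlt[OF that] tl[OF that] tp d_pos by (cases "i = p") (auto simp: rot_eq)
  let ?f = "\<lambda>t i. if t i > t (rot d i) then q ^ Suc i else 1"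
  have split: "(\<Prod>i<d. ?f t i) = ?f t p * (?f t p' * (\<Prod>i\<in>{..<d} - {p} - {p'}. ?f t i))" for t :: "nat \<Rightarrow> nat"
    using p p' ne by (simp add: prod.remove[of "{..<d}" p] prod.remove[of "{..<d} - {p}" p'])
  have rest: "(\<Prod>i\<in>{..<d} - {p} - {p'}. ?f (rot d \<circ> t) i) = (\<Prod>i\<in>{..<d} - {p} - {p'}. ?f t i)"
  proof (intro prod.cong refl)
    fix i assume i: "i \<in> {..<d} - {p} - {p'}"
    then have "rot d i \<noteq> p" using rp' permutes_inj[OF rot_permutes, of d] by (auto simp: inj_eq)
    then show "?f (rot d \<circ> t) i = ?f t i" using i rot_less[of i d] by (simp add: rt)
  qed
  have a: "?f t p = q ^ Suc p" using tlt[of "rot d p"] rne[OF p] rot_less[OF p] tp by simp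
  have b: "?f t p' = 1" using tlt[OF p'] ne tp by (simp add: rp')
  have c: "?f (rot d \<circ> t) p = 1" using rot_less[OF p] p rne[OF p] by (simp add: rt)
  have e: "?f (rot d \<circ> t) p' = q ^ Suc p'" using p p' ne by (simp add: rp' rt)
  have "q * q ^ Suc p' = q ^ Suc p" using q_pow_Suc_rot[OF p'] unfolding rp' by (rule sym)
  then show ?thesis unfolding maj_weight_cyclic split rest a b c e by (simp only: mult_1 mult.assoc[symmetric])
qed

lemma maj_weight_rot_pow_left:
  assumes t: "t permutes {..<d}"
  shows "q ^ k * maj_weight (rot d ^^ k \<circ> t) = maj_weight t"
proof (induction k)
  case (Suc k)
  have "q ^ Suc k * maj_weight (rot d ^^ Suc k \<circ> t) = q ^ k * (q * maj_weight (rot d \<circ> (rot d ^^ k \<circ> t)))"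
    by (simp add: comp_assoc)
  then show ?case
    unfolding maj_weight_rot_left[OF permutes_compose[OF t rot_pow_permutes]] Suc .
qed simp

lemma maj_weight_rot_pow_right: "maj_weight t = q ^ (k * cyclic_descents d t) * maj_weight (t \<circ> rot d ^^ k)"
proof (induction k)
  case (Suc k)
  have "maj_weight (t \<circ> rot d ^^ k) = q ^ cyclic_descents d t * maj_weight (t \<circ> rot d ^^ Suc k)"
    unfolding funpow_Suc_right comp_assoc[symmetric]
    using maj_weight_rot_right[of "t \<circ> rot d ^^ k"] by (simp only: cyclic_descents_rot_pow)
  moreover have "q ^ (Suc k * cyclic_descents d t) = q ^ (k * cyclic_descents d t) * q ^ cyclic_descents d t"
    by (simp only: mult_Suc power_add mult.commute)
  ultimately show ?case using Suc by (simp only: mult.assoc)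
qed simp

lemma sum_pow_root: "(\<Sum>k<d. q ^ (k * e)) = (if d dvd e then of_nat d else 0)"
proof (cases "d dvd e")
  case True
  then obtain a where "e = d * a" by blast
  then have "q ^ (k * e) = 1" for k by (metis mult.left_commute power_mult power_one q_pow_d)
  then show ?thesis using True by simp
next
  case False
  have "q ^ e = q ^ (e mod d)"
    by (metis div_mult_mod_eq mult.commute mult_1 power_add power_mult power_one q_pow_d)
  moreover have "0 < e mod d" "e mod d < d" using False d_pos by (auto simp: dvd_eq_mod_eq_0)
  ultimately have ne: "q ^ e \<noteq> 1" using q_pow_neq_1 by simp
  have "(\<Sum>k<d. q ^ (k * e)) = (\<Sum>k<d. (q ^ e) ^ k)" by (simp add: mult.commute flip: power_mult)
  also have "\<dots> = ((q ^ e) ^ d - 1) / (q ^ e - 1)" using ne by (rule geometric_sum)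
  also have "(q ^ e) ^ d = 1" by (metis mult.commute power_mult power_one q_pow_d)
  finally show ?thesis using False by simp
qed

text \<open>The condition says that there is one cyclic descent modulo \<open>d\<close>, with
  \<open>d - 1\<close> standing for -1 among the naturals. Rotating the value 0 to the front then
  leaves an increasing permutation.\<close>

lemma cyclic_descents_rotation:
  assumes t: "t permutes {..<d}"
  shows "d dvd cyclic_descents d t + (d - 1) \<longleftrightarrow> t \<in> (\<lambda>k. inv (rot d ^^ k)) ` {..<d}"
proof
  assume dv: "d dvd cyclic_descents d t + (d - 1)"
  define p where "p = inv t 0"
  have p: "p < d" using permutes_in_image[OF permutes_inv[OF t], of 0] d_pos by (simp add: p_def)
  let ?c = "rot d ^^ p"
  have tc: "t \<circ> ?c permutes {..<d}" by (rule permutes_compose[OF rot_pow_permutes t])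
  have "t \<circ> ?c = id"
  proof (cases "d = 1")
    case True
    then show ?thesis using tc by (simp add: lessThan_Suc)
  next
    case False
    then have d2: "d \<ge> 2" using d_pos by simp
    have "(t \<circ> ?c) 0 = 0" using p d_pos by (simp add: rot_pow p_def permutes_inverses[OF t])
    moreover have "cyclic_descents d t = 1"
    proof -
      obtain k where k: "cyclic_descents d t + (d - 1) = d * k" using dv by blast
      \<comment> \<open>By \<open>cyclic_descents_less\<close> the multiple of \<open>d\<close> lies
        strictly between 0 and \<open>d * 2\<close>, so it is \<open>d\<close>.\<close>
      have "d * k < d * 2" "d * 0 < d * k" using k cyclic_descents_less[OF t d_pos] d2 by linarith+
      then have "k = 1" using d_pos by (simp only: nat_mult_less_cancel_disj) simp
      then show ?thesis using k d2 by simp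
    qed
    ultimately show ?thesis using cyclic_descents_1_imp_id[OF tc _ d2] by (simp add: cyclic_descents_rot_pow)
  qed
  then have "t \<circ> (?c \<circ> inv ?c) = inv ?c" by (simp only: comp_assoc[symmetric] id_comp)
  then have "t = inv ?c" unfolding permutes_inv_o(1)[OF rot_pow_permutes] by simp
  then show "t \<in> (\<lambda>k. inv (rot d ^^ k)) ` {..<d}" using p by blast
next
  assume "t \<in> (\<lambda>k. inv (rot d ^^ k)) ` {..<d}"
  then obtain k where k: "t = inv (rot d ^^ k)" by blast
  have "t \<circ> rot d ^^ k = id" unfolding k using permutes_inv_o(2)[OF rot_pow_permutes] .
  then have "cyclic_descents d t = cyclic_descents d id" by (metis cyclic_descents_rot_pow)
  then show "d dvd cyclic_descents d t + (d - 1)" using d_pos by (auto simp: cyclic_descents_id)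
qed

text \<open>Translating by a power of the cycle on the left multiplies the
  weight by a fixed power of \<open>q\<close>, translating on the right by one that depends on the number of
  cyclic descents; averaging kills all permutations except the rotations.\<close>

theorem sum_maj_weight_class_function:
  fixes h :: "(nat \<Rightarrow> nat) \<Rightarrow> complex"
  assumes h: "\<And>s t. s permutes {..<d} \<Longrightarrow> t permutes {..<d} \<Longrightarrow> h (s \<circ> t) = h (t \<circ> s)"
  shows "(\<Sum>s | s permutes {..<d}. maj_weight (inv s) * h s) = (\<Sum>k<d. q ^ k * h (rot d ^^ k))"
proof -
  let ?S = "{s. s permutes {..<d}}"
  let ?D = "\<lambda>t. maj_weight t * h (inv t)"
  let ?R = "(\<lambda>k. inv (rot d ^^ k)) ` {..<d}"
  define T where "T = (\<Sum>t\<in>?S. ?D t)"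
  have T: "(\<Sum>s\<in>?S. maj_weight (inv s) * h s) = T"
    unfolding T_def by (subst sum_permutations_inverse) (auto simp: permutes_inv_inv intro!: sum.cong)
  \<comment> \<open>The sum is reindexed by left translation and then compared with right
    translation; \<open>h\<close>, being a class function, has the same value at both.\<close>
  have qk: "q ^ k * T = (\<Sum>t\<in>?S. q ^ (k * cyclic_descents d t) * ?D t)" for k
  proof -
    let ?c = "rot d ^^ k"
    have c: "?c permutes {..<d}" by (rule rot_pow_permutes)
    have "q ^ k * T = (\<Sum>t\<in>?S. q ^ k * ?D (?c \<circ> t))"
      unfolding T_def sum_distrib_left by (rule setum_permutations_compose_left[OF c])
    also have "\<dots> = (\<Sum>t\<in>?S. q ^ (k * cyclic_descents d (t \<circ> ?c)) * ?D (t \<circ> ?c))"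
    proof (intro sum.cong refl)
      fix t assume "t \<in> ?S"
      then have t: "t permutes {..<d}" by simp
      have "h (inv (?c \<circ> t)) = h (inv (t \<circ> ?c))"
        using h[OF permutes_inv[OF t] permutes_inv[OF c]]
        by (simp add: o_inv_distrib permutes_bij[OF t] permutes_bij[OF c])
      moreover have "q ^ k * maj_weight (?c \<circ> t) = q ^ (k * cyclic_descents d (t \<circ> ?c)) * maj_weight (t \<circ> ?c)"
        unfolding maj_weight_rot_pow_left[OF t] cyclic_descents_rot_pow by (rule maj_weight_rot_pow_right)
      ultimately show "q ^ k * ?D (?c \<circ> t) = q ^ (k * cyclic_descents d (t \<circ> ?c)) * ?D (t \<circ> ?c)"
        by (simp only: mult.assoc[symmetric])
    qed
    also have "\<dots> = (\<Sum>t\<in>?S. q ^ (k * cyclic_descents d t) * ?D t)"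
      by (rule sum_permutations_compose_right[OF c, symmetric])
    finally show ?thesis .
  qed
  \<comment> \<open>Exponents are natural numbers; multiplication by
    \<open>q ^ (k * (d - 1))\<close> undoes \<open>q ^ k\<close>.\<close>
  have "T = q ^ (k * (d - 1)) * (q ^ k * T)" for k
  proof -
    have "k * (d - 1) + k = d * k" using d_pos by (cases d) simp_all
    then have "q ^ (k * (d - 1)) * q ^ k = 1" by (metis power_add power_mult power_one q_pow_d)
    then show ?thesis by (metis mult.assoc mult_1)
  qed
  then have TK: "T = (\<Sum>t\<in>?S. q ^ (k * (cyclic_descents d t + (d - 1))) * ?D t)" for k
    unfolding qk sum_distrib_left by (simp add: power_add distrib_left mult.assoc mult.left_commute)
  have "of_nat d * T = (\<Sum>k<d. T)" by simp
  also have "\<dots> = (\<Sum>k<d. \<Sum>t\<in>?S. q ^ (k * (cyclic_descents d t + (d - 1))) * ?D t)"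
    by (rule sum.cong[OF refl TK])
  also have "\<dots> = (\<Sum>t\<in>?S. (\<Sum>k<d. q ^ (k * (cyclic_descents d t + (d - 1)))) * ?D t)"
    unfolding sum_distrib_right by (rule sum.swap)
  \<comment> \<open>The sum over \<open>k\<close> selects those \<open>t\<close> for which
    \<open>d\<close> divides the exponent, and these are the rotations.\<close>
  also have "\<dots> = (\<Sum>t\<in>?S. if t \<in> ?R then of_nat d * ?D t else 0)"
    unfolding sum_pow_root by (intro sum.cong refl) (use cyclic_descents_rotation in auto)
  also have "\<dots> = (\<Sum>t\<in>?R. of_nat d * ?D t)"
  proof -
    have "?R \<subseteq> ?S" using permutes_inv[OF rot_pow_permutes] by auto
    then show ?thesis by (simp add: sum.inter_restrict[symmetric] finite_permutations Int_absorb1)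
  qed
  also have "\<dots> = (\<Sum>k<d. of_nat d * ?D (inv (rot d ^^ k)))"
  proof -
    have "inj_on (\<lambda>k. inv (rot d ^^ k)) {..<d}"
      using rot_pow_inj[of d] permutes_inv_inv[OF rot_pow_permutes] unfolding inj_on_def by metis
    then show ?thesis by (simp add: sum.reindex)
  qed
  also have "\<dots> = of_nat d * (\<Sum>k<d. q ^ k * h (rot d ^^ k))"
  proof -
    have "?D (inv (rot d ^^ k)) = q ^ k * h (rot d ^^ k)" for k
    proof -
      have "maj_weight (inv (rot d ^^ k)) = q ^ k * maj_weight (rot d ^^ k \<circ> inv (rot d ^^ k))"
        by (rule maj_weight_rot_pow_left[symmetric, OF permutes_inv[OF rot_pow_permutes]])
      also have "maj_weight (rot d ^^ k \<circ> inv (rot d ^^ k)) = 1"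
        unfolding permutes_inv_o(1)[OF rot_pow_permutes] by (simp add: desc_weight_def)
      finally show ?thesis by (simp add: permutes_inv_inv[OF rot_pow_permutes])
    qed
    then show ?thesis by (simp add: sum_distrib_left)
  qed
  finally show ?thesis using d_pos T by simp
qed

end

section \<open>The Frobenius characteristic of an induced character\<close>

text \<open>Trace of the place permutation \<open>s\<close> composed with the diagonal matrix of
  \<open>x\<close> on the \<open>d\<close>-th tensor power of C^N, in the basis of words.\<close>

definition fixed_words_sum :: "nat \<Rightarrow> nat \<Rightarrow> (nat \<Rightarrow> complex) \<Rightarrow> (nat \<Rightarrow> nat) \<Rightarrow> complex" where
  "fixed_words_sum N d x s =
     (\<Sum>u | set u \<subseteq> {..<N} \<and> length u = d \<and> permute_list s u = u. prod_list (map x u))"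

lemma prod_list_permute_list:
  assumes "s permutes {..<length u}"
  shows "prod_list (map x (permute_list s u)) = (prod_list (map x u) :: 'a :: comm_monoid_mult)"
proof -
  have "prod_mset (image_mset x (mset (permute_list s u))) = prod_mset (image_mset x (mset u))"
    using assms by simp
  then show ?thesis by (metis mset_map prod_mset_prod_list)
qed

lemma fixed_words_sum_conj:
  assumes s: "s permutes {..<d}" and t: "t permutes {..<d}"
  shows "fixed_words_sum N d x (t \<circ> s \<circ> inv t) = fixed_words_sum N d x s"
  unfolding fixed_words_sum_def
proof (rule sum.reindex_bij_witness[where i = "permute_list (inv t)" and j = "permute_list t"])
  have pc: "permute_list f (permute_list g u) = permute_list (g \<circ> f) u" if "f permutes {..<d}" "length u = d" for f g and u :: "nat list"
    using permute_list_compose[of f u g] that by simp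
  note ti = permutes_inv[OF t]
  have st: "t \<circ> s permutes {..<d}" using permutes_compose[OF s t] .
  fix u :: "nat list"
  { assume "u \<in> {u. set u \<subseteq> {..<N} \<and> length u = d \<and> permute_list (t \<circ> s \<circ> inv t) u = u}"
    then have u: "set u \<subseteq> {..<N}" "length u = d" "permute_list (t \<circ> s \<circ> inv t) u = u" by auto
    show "permute_list (inv t) (permute_list t u) = u"
      using u by (simp add: pc[OF ti] permutes_inv_o[OF t])
    have "permute_list s (permute_list t u) = permute_list t (permute_list (t \<circ> s \<circ> inv t) u)"
      using u(2) by (simp add: pc s t permutes_inv_o[OF t] comp_assoc)
    then show "permute_list t u \<in> {u. set u \<subseteq> {..<N} \<and> length u = d \<and> permute_list s u = u}"
      using u t by simp
    show "prod_list (map x (permute_list t u)) = prod_list (map x u)"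
      using u t by (intro prod_list_permute_list) simp
  }
  { assume "u \<in> {u. set u \<subseteq> {..<N} \<and> length u = d \<and> permute_list s u = u}"
    then have u: "set u \<subseteq> {..<N}" "length u = d" "permute_list s u = u" by auto
    show "permute_list t (permute_list (inv t) u) = u"
      using u by (simp add: pc[OF t] permutes_inv_o[OF t])
    have "permute_list (t \<circ> s \<circ> inv t) (permute_list (inv t) u) = permute_list (inv t) (permute_list s u)"
      using u(2) by (simp add: pc permutes_compose[OF ti st] ti s permutes_inv_o[OF t] flip: comp_assoc)
    then show "permute_list (inv t) u \<in> {u. set u \<subseteq> {..<N} \<and> length u = d \<and> permute_list (t \<circ> s \<circ> inv t) u = u}"
      using u ti by simp
  }
qed

text \<open>A word is fixed by \<open>s\<close> iff it is constant on the cycles, so expanding the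
  product of power sums amounts to choosing a letter for each cycle.\<close>

lemma prod_psum_cycles:
  assumes s: "s permutes {..<d}"
  shows "(\<Prod>c\<in>cycles_of d s. psum N x (card c)) = fixed_words_sum N d x s"
proof -
  define orb where "orb i = {(s ^^ k) i | k. True}" for i
  have C: "cycles_of d s = orb ` {..<d}" by (auto simp: cycles_of_def orb_def atLeast0LessThan)
  have sk: "(s ^^ k) i < d" if "i < d" for k i
    using permutes_in_image[OF s] that by (induction k) auto
  have sub: "orb i \<subseteq> {..<d}" if "i < d" for i using sk[OF that] by (auto simp: orb_def)
  have self: "i \<in> orb i" for i unfolding orb_def by (rule CollectI, rule exI[of _ 0]) simp
  have orb_sub: "orb j \<subseteq> orb i" if "j \<in> orb i" for i j
    using that by (auto simp: orb_def) (metis comp_apply funpow_add)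
  have orb_eq: "orb j = orb i" if "j \<in> orb i" "i < d" for i j
  proof -
    obtain k where k: "j = (s ^^ k) i" using \<open>j \<in> orb i\<close> by (auto simp: orb_def)
    have "finite {y. \<exists>n. y = (s ^^ n) i}" using sub[OF that(2)] finite_subset unfolding orb_def by fastforce
    then obtain n where n: "n > 0" "(s ^^ n) i = i"
      using funpow_inj_finite[OF permutes_inj[OF s]] by metis
    have "(s ^^ (n * k)) i = i" using n(2) by (induction k) (simp_all add: funpow_add)
    moreover have "n * k = (n * k - k) + k" using n(1) by simp
    \<comment> \<open>Cycles are encoded as forward orbits. Since \<open>s ^^ n\<close> fixes
      \<open>i\<close>, another \<open>n * k - k\<close> steps from \<open>j\<close> lead back to
      \<open>i\<close>.\<close>
    ultimately have "(s ^^ (n * k - k)) j = i" unfolding k by (metis comp_apply funpow_add)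
    then have "i \<in> orb j" by (auto simp: orb_def)
    then show ?thesis using orb_sub that(1) by blast
  qed
  have sorb: "orb (s i) = orb i" if "i < d" for i
    by (rule orb_eq[OF _ that]) (auto simp: orb_def intro: exI[of _ 1])
  define rep where "rep c = (SOME i. i \<in> c)" for c :: "nat set"
  have rep: "rep (orb i) \<in> orb i" for i unfolding rep_def using self by (rule someI)
  have fc: "u ! ((s ^^ k) i) = u ! i" if "length u = d" "permute_list s u = u" "i < d" for u :: "nat list" and i k
  proof (induction k)
    case (Suc k)
    have "u ! (s ((s ^^ k) i)) = permute_list s u ! ((s ^^ k) i)"
      using that sk s by (subst permute_list_nth) auto
    then show ?case using Suc that(2) by simp
  qed simp
  have "(\<Prod>c\<in>cycles_of d s. psum N x (card c)) = (\<Prod>c\<in>orb ` {..<d}. \<Sum>i\<in>{..<N}. x i ^ card c)"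
    by (simp add: C psum_def)
  also have "\<dots> = (\<Sum>g\<in>PiE (orb ` {..<d}) (\<lambda>_. {..<N}). \<Prod>c\<in>orb ` {..<d}. x (g c) ^ card c)"
    by (intro prod_sum_PiE) auto
  also have "\<dots> = fixed_words_sum N d x s"
    unfolding fixed_words_sum_def
  proof (rule sum.reindex_bij_witness[where j = "\<lambda>g. map (\<lambda>i. g (orb i)) [0..<d]"
        and i = "\<lambda>u. restrict (\<lambda>c. u ! rep c) (orb ` {..<d})"])
    fix g assume g: "g \<in> PiE (orb ` {..<d}) (\<lambda>_. {..<N})"
    let ?u = "map (\<lambda>i. g (orb i)) [0..<d]"
    have rd: "rep (orb i) < d" if "i < d" for i using rep[of i] sub[OF that] by auto
    have ro: "orb (rep (orb i)) = orb i" if "i < d" for i using orb_eq[OF rep that] .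
    show "restrict (\<lambda>c. ?u ! rep c) (orb ` {..<d}) = g"
      using g by (auto simp: PiE_def extensional_def restrict_def fun_eq_iff rd ro)
    have "permute_list s ?u = ?u"
      using s sorb by (intro nth_equalityI) (auto simp: permute_list_nth permutes_in_image[OF s, simplified])
    then show "?u \<in> {u. set u \<subseteq> {..<N} \<and> length u = d \<and> permute_list s u = u}"
      using g by auto
    have "prod_list (map x ?u) = (\<Prod>i<d. x (g (orb i)))"
      by (simp add: prod.list_conv_set_nth atLeast0LessThan)
    also have "\<dots> = (\<Prod>c\<in>orb ` {..<d}. \<Prod>i\<in>{i \<in> {..<d}. orb i = c}. x (g (orb i)))"
      by (rule prod.image_gen) simp
    also have "\<dots> = (\<Prod>c\<in>orb ` {..<d}. x (g c) ^ card c)"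
    proof (intro prod.cong refl)
      fix c assume "c \<in> orb ` {..<d}"
      then obtain i where i: "i < d" "c = orb i" by auto
      have "{j \<in> {..<d}. orb j = c} = c"       proof (intro set_eqI iffI)
        fix j assume "j \<in> {j \<in> {..<d}. orb j = c}"
        then show "j \<in> c" using self[of j] by simp
      next
        fix j assume "j \<in> c"
        then show "j \<in> {j \<in> {..<d}. orb j = c}" using orb_eq[OF _ i(1)] sub[OF i(1)] unfolding i(2) by blast
      qed
      moreover have "(\<Prod>j\<in>{j \<in> {..<d}. orb j = c}. x (g (orb j))) = (\<Prod>j\<in>{j \<in> {..<d}. orb j = c}. x (g c))"
        by (intro prod.cong) auto
      ultimately show "(\<Prod>j\<in>{j \<in> {..<d}. orb j = c}. x (g (orb j))) = x (g c) ^ card c" by simp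
    qed
    finally show "prod_list (map x ?u) = (\<Prod>c\<in>orb ` {..<d}. x (g c) ^ card c)" .
  next
    fix u :: "nat list" assume "u \<in> {u. set u \<subseteq> {..<N} \<and> length u = d \<and> permute_list s u = u}"
    then have u: "set u \<subseteq> {..<N}" "length u = d" "permute_list s u = u" by auto
    have r: "u ! rep (orb i) = u ! i" if "i < d" for i
      using rep[of i] fc[OF u(2,3) that] by (auto simp: orb_def)
    show "map (\<lambda>i. restrict (\<lambda>c. u ! rep c) (orb ` {..<d}) (orb i)) [0..<d] = u"
      using u(2) r by (intro nth_equalityI) auto
    show "restrict (\<lambda>c. u ! rep c) (orb ` {..<d}) \<in> PiE (orb ` {..<d}) (\<lambda>_. {..<N})"
      using r u by (auto simp: subset_iff set_conv_nth)
  qed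
  finally show ?thesis .
qed

text \<open>Frobenius reciprocity: the product of power sums is a class function, so conjugation by
  \<open>t\<close> leaves the sum over the whole symmetric group unchanged, and the number of
  choices of \<open>t\<close> cancels the factorial.\<close>

lemma frob_induce_cyc:
  assumes C: "\<And>c. c \<in> cyc_group d \<Longrightarrow> c permutes {..<d}"
  shows "frob d (induce_cyc d psi) N x =
    (1 / of_nat (card (cyc_group d))) * (\<Sum>c\<in>cyc_group d. psi c * fixed_words_sum N d x c)"
proof -
  let ?S = "{s. s permutes {..<d}}"
  let ?C = "cyc_group d" and ?P = "fixed_words_sum N d x"
  let ?b = "1 / of_nat (card ?C) :: complex"
  have fS: "finite ?S" by (rule finite_permutations) simp
  have CS: "?C \<subseteq> ?S" using C by auto
  define F where "F r = (if r \<in> ?C then psi r * ?P r else 0)" for r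
  have conj: "(\<Sum>s\<in>?S. F (t \<circ> s \<circ> inv t)) = (\<Sum>s\<in>?S. F s)" if t: "t \<in> ?S" for t
  proof -
    have t: "t permutes {..<d}" using t by simp
    have "(\<Sum>s\<in>?S. F s) = (\<Sum>s\<in>?S. F (t \<circ> s))" by (rule setum_permutations_compose_left[OF t])
    also have "\<dots> = (\<Sum>s\<in>?S. F (t \<circ> (s \<circ> inv t)))"
      by (rule sum_permutations_compose_right[OF permutes_inv[OF t]])
    finally show ?thesis by (simp add: comp_assoc)
  qed
  have "frob d (induce_cyc d psi) N x = (1 / of_nat (fact d)) * (\<Sum>s\<in>?S. induce_cyc d psi s * ?P s)"
    unfolding frob_def by (simp add: atLeast0LessThan prod_psum_cycles)
  also have "(\<Sum>s\<in>?S. induce_cyc d psi s * ?P s) = (\<Sum>s\<in>?S. ?b * (\<Sum>t\<in>?S. F (t \<circ> s \<circ> inv t)))"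
  proof (intro sum.cong refl)
    fix s assume s: "s \<in> ?S"
    have "induce_cyc d psi s = ?b * (\<Sum>t\<in>{t \<in> ?S. t \<circ> s \<circ> inv t \<in> ?C}. psi (t \<circ> s \<circ> inv t))"
      by (simp add: induce_cyc_def atLeast0LessThan)
    also have "(\<Sum>t\<in>{t \<in> ?S. t \<circ> s \<circ> inv t \<in> ?C}. psi (t \<circ> s \<circ> inv t)) =
        (\<Sum>t\<in>?S. if t \<circ> s \<circ> inv t \<in> ?C then psi (t \<circ> s \<circ> inv t) else 0)"
      by (rule sum.inter_filter[OF fS])
    finally have e: "induce_cyc d psi s = ?b * (\<Sum>t\<in>?S. if t \<circ> s \<circ> inv t \<in> ?C then psi (t \<circ> s \<circ> inv t) else 0)" .
    show "induce_cyc d psi s * ?P s = ?b * (\<Sum>t\<in>?S. F (t \<circ> s \<circ> inv t))"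
      unfolding e sum_distrib_left sum_distrib_right mult.assoc
      using s by (intro sum.cong refl) (simp add: F_def fixed_words_sum_conj)
  qed
  also have "\<dots> = ?b * (\<Sum>t\<in>?S. \<Sum>s\<in>?S. F (t \<circ> s \<circ> inv t))"
    unfolding sum_distrib_left[symmetric] by (rule arg_cong[OF sum.swap])
  also have "\<dots> = ?b * (of_nat (fact d) * (\<Sum>s\<in>?S. F s))"
    using conj card_permutations[of "{..<d}" d] by simp
  also have "(\<Sum>s\<in>?S. F s) = (\<Sum>c\<in>?C. psi c * ?P c)"
    unfolding F_def using CS fS by (subst sum.inter_restrict[symmetric]) (auto simp: Int_absorb1)
  finally show ?thesis by simp
qed

section \<open>Signs of rotations and the character formula\<close>

lemma sum_shift_periodic:
  fixes g :: "nat \<Rightarrow> nat"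
  assumes "\<And>i. g (i + p) = g i"
  shows "(\<Sum>i<p. g (s + i)) = (\<Sum>i<p. g i)"
proof (induction s)
  case (Suc s)
  have "(\<Sum>i<p. g (Suc s + i)) + g s = (\<Sum>i<Suc p. g (s + i))"
    unfolding sum.lessThan_Suc_shift by simp
  also have "\<dots> = (\<Sum>i<p. g (s + i)) + g s" using assms[of s] by simp
  finally show ?case using Suc by simp
qed simp

text \<open>The same double sum is counted as \<open>d\<close> windows of length \<open>k\<close>
  and as \<open>k\<close> windows of length \<open>d\<close>; by periodicity all windows of one
  length have equal sums.\<close>

lemma sum_window_periodic:
  fixes g :: "nat \<Rightarrow> nat"
  assumes "\<And>i. g (i + d) = g i" "\<And>i. g (i + k) = g i"
  shows "d * (\<Sum>i<k. g i) = k * (\<Sum>i<d. g i)"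
proof -
  have "(\<Sum>s<d. \<Sum>i<k. g (s + i)) = (\<Sum>i<k. \<Sum>s<d. g (i + s))"
    by (subst sum.swap) (simp add: add.commute)
  then show ?thesis by (simp add: sum_shift_periodic[of g, OF assms(1)] sum_shift_periodic[of g, OF assms(2)])
qed

lemma odd_len_conv_sum: "odd_len w = (\<Sum>i<length w. of_bool (fst (w ! i)))"
  by (simp add: odd_len_def length_filter_conv_card sum.If_cases of_bool_def Int_def)

text \<open>The rotation takes the first letter past all the others. If
  \<open>odd_len w = 0\<close>, the truncated difference is harmless because the first letter is
  even.\<close>

lemma place_sign_rot:
  assumes "length w = d" "d > 0"
  shows "place_sign w (rot d) = (-1) ^ ((odd_len w - 1) * of_bool (fst (w ! 0)))"
proof -
  let ?p = "\<lambda>i. fst (w ! i)"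
  have r: "map (rot d) [0..<d] = [1..<d] @ [0]"
    using assms(2) by (intro nth_equalityI) (auto simp: rot_eq nth_append)
  have c: "[0..<d] = 0 # [1..<d]" using assms(2) by (simp add: upt_conv_Cons)
  have "odd_len w = length (filter ?p [0..<d])"
    unfolding odd_len_def by (subst map_nth[of w, symmetric]) (simp only: filter_map length_map assms(1) o_def)
  also have "\<dots> = of_bool (fst (w ! 0)) + length (filter ?p [1..<d])" unfolding c by simp
  finally have o: "odd_len w = of_bool (fst (w ! 0)) + length (filter ?p [1..<d])" .
  have "place_sign w (rot d) = (-1) ^ (of_bool (?p 0) * length (filter ?p [1..<d])) * koszul ?p (0 # [1..<d] @ [])"
    unfolding place_sign_def assms(1) r by (rule koszul_move) simp
  also have "koszul ?p (0 # [1..<d] @ []) = 1" using koszul_upt[of ?p d] unfolding c by simp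
  finally show ?thesis using o by (simp add: mult.commute)
qed

text \<open>By the cocycle rule the first letters are moved to the end in turn, and each odd one
  passes the other \<open>odd_len w - 1\<close> odd letters. Indices are taken modulo
  \<open>d\<close> because \<open>k\<close> may exceed \<open>d\<close>.\<close>

lemma place_sign_rot_pow:
  assumes "length w = d" "d > 0"
  shows "place_sign w (rot d ^^ k) = (-1) ^ ((odd_len w - 1) * (\<Sum>i<k. of_bool (fst (w ! (i mod d)))))"
proof (induction k)
  case 0
  then show ?case by (simp add: place_sign_def koszul_upt)
next
  case (Suc k)
  have r: "rot d ^^ k permutes {..<length w}" "rot d permutes {..<length w}"
    using rot_pow_permutes rot_permutes assms(1) by auto
  let ?v = "permute_list (rot d ^^ k) w"
  have 1: "odd_len ?v = odd_len w"
    unfolding odd_len_def by (metis mset_filter mset_permute_list size_mset r(1))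
  have 2: "?v ! 0 = w ! (k mod d)"
    using assms by (simp add: permute_list_nth[OF r(1)] rot_pow)
  have 3: "place_sign w (rot d ^^ Suc k) = place_sign w (rot d ^^ k) * place_sign ?v (rot d)"
    unfolding funpow_Suc_right by (rule place_sign_compose[OF r])
  have "place_sign ?v (rot d) = (-1) ^ ((odd_len w - 1) * of_bool (fst (w ! (k mod d))))"
    using place_sign_rot[of ?v d] assms unfolding 1 2 by simp
  then show ?case unfolding 3 Suc by (simp only: sum.lessThan_Suc distrib_left power_add)
qed

text \<open>By \<open>d * a = k * m\<close> the angle of the power on the left is \<open>a\<close>
  times pi.\<close>

lemma cis_pow_half:
  assumes "d > 0" "even m" "d * a = k * m"
  shows "cis (2 * pi / real d) ^ (m div 2 * k) = (-1) ^ a"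
proof -
  obtain l where l: "m = 2 * l" using assms(2) by blast
  have "real (d * a) = real (k * (2 * l))" using assms(3) unfolding l by (rule arg_cong)
  then have "real d * real a = real k * (2 * real l)" by simp
  then have "real (l * k) * (2 * pi / real d) = real a * pi"
    using assms(1) by (simp add: field_simps)
  then have "cis (2 * pi / real d) ^ (l * k) = cis pi ^ a"
    by (simp only: DeMoivre)
  then show ?thesis using l by simp
qed

lemma place_sign_fixed_rot_pow:
  assumes "length w = d" "d > 0" and fixed: "permute_list (rot d ^^ k) w = w"
  shows "place_sign w (rot d ^^ k) =
    (if odd (odd_len w) then 1 else cis (2 * pi / real d) ^ (odd_len w div 2 * k))"
proof -
  let ?m = "odd_len w"
  \<comment> \<open>The indicator of odd letters, continued with period \<open>d\<close>; being
    fixed by the rotation adds the period \<open>k\<close>.\<close>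
  define g where "g i = (of_bool (fst (w ! (i mod d))) :: nat)" for i
  define a where "a = (\<Sum>i<k. g i)"
  have r: "rot d ^^ k permutes {..<length w}" using rot_pow_permutes assms(1) by auto
  have "g (i + k) = g i" for i
  proof -
    have i: "i mod d < d" using assms(2) by simp
    have "w ! (i mod d) = permute_list (rot d ^^ k) w ! (i mod d)" using fixed by simp
    also have "\<dots> = w ! ((i + k) mod d)"
      using i assms(1) by (simp add: permute_list_nth[OF r] rot_pow mod_add_left_eq)
    finally show ?thesis by (simp add: g_def)
  qed
  moreover have "g (i + d) = g i" for i by (simp add: g_def)
  moreover have "(\<Sum>i<d. g i) = ?m" unfolding odd_len_conv_sum assms(1) by (intro sum.cong) (simp_all add: g_def)
  ultimately have da: "d * a = k * ?m" unfolding a_def using sum_window_periodic[of g d k] by simp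
  have ps: "place_sign w (rot d ^^ k) = (-1) ^ ((?m - 1) * a)"
    using place_sign_rot_pow[OF assms(1,2), of k] by (simp add: a_def g_def)
  show ?thesis
  proof (cases "odd ?m")
    case True
    then have "even ((?m - 1) * a)" by simp
    then show ?thesis using True ps by simp
  next
    case False
    have "(-1) ^ ((?m - 1) * a) = ((-1) ^ a :: complex)"
    \<comment> \<open>For \<open>?m = 0\<close> the truncated difference \<open>?m - 1\<close> is
      even, but then \<open>a = 0\<close>.\<close>
    proof (cases "?m = 0")
      case True
      then show ?thesis using da assms(2) by simp
    next
      case m: False
      then have "odd (?m - 1)" using False by simp
      then show ?thesis by (simp add: power_mult)
    qed
    then show ?thesis using ps False cis_pow_half[OF assms(2) _ da] by simp
  qed
qed

text \<open>Trace of the signed place permutation by \<open>s\<close> composed with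
  \<open>diag_act x\<close> on the tensors of bidegree \<open>(n, m)\<close>.\<close>

definition signed_fixed_sum :: "nat \<Rightarrow> nat \<Rightarrow> nat \<Rightarrow> (nat \<Rightarrow> complex) \<Rightarrow> (nat \<Rightarrow> nat) \<Rightarrow> complex" where
  "signed_fixed_sum N n m x s = (\<Sum>w | w \<in> bideg_words N n m \<and> permute_list s w = w.
     place_sign w s * prod_list (map (\<lambda>a. x (snd a)) w))"

text \<open>The trace property: \<open>permute_list s\<close> maps the words fixed by
  \<open>s \<circ> t\<close> to those fixed by \<open>t \<circ> s\<close>, with equal signs by the
  cocycle rule.\<close>

lemma signed_fixed_sum_commute:
  assumes s: "s permutes {..<n + m}" and t: "t permutes {..<n + m}"
  shows "signed_fixed_sum N n m x (s \<circ> t) = signed_fixed_sum N n m x (t \<circ> s)"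
  unfolding signed_fixed_sum_def
proof (rule sum.reindex_bij_witness[where i = "permute_list t" and j = "permute_list s"])
  have *: "permute_list g (permute_list f w) = w \<and> permute_list f w \<in> bideg_words N n m \<and>
      permute_list (g \<circ> f) (permute_list f w) = permute_list f w \<and>
      place_sign (permute_list f w) (g \<circ> f) * prod_list (map (\<lambda>a. x (snd a)) (permute_list f w)) =
      place_sign w (f \<circ> g) * prod_list (map (\<lambda>a. x (snd a)) w)"
    if "w \<in> {w. w \<in> bideg_words N n m \<and> permute_list (f \<circ> g) w = w}"
      and f: "f permutes {..<n + m}" and g: "g permutes {..<n + m}" for f g w
  proof -
    have w: "w \<in> bideg_words N n m" "permute_list (f \<circ> g) w = w" using that(1) by auto
    have l: "length w = n + m" using length_bideg_words[OF w(1)] .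
    let ?v = "permute_list f w"
    have gv: "permute_list g ?v = w" using w(2) permute_list_compose[of g w f] g l by simp
    have "place_sign ?v (g \<circ> f) = place_sign ?v g * place_sign w f"
      using place_sign_compose[of g ?v f] f g l gv by simp
    moreover have "place_sign w (f \<circ> g) = place_sign w f * place_sign ?v g"
      using place_sign_compose[of f w g] f g l by simp
    moreover have "permute_list (g \<circ> f) ?v = ?v"
      using permute_list_compose[of f ?v g] f l gv by simp
    ultimately show ?thesis
      using gv permute_bideg_words[of f w] prod_list_permute_list[of f w "\<lambda>a. x (snd a)"] f l w(1) by simp
  qed
  fix w
  { assume "w \<in> {w. w \<in> bideg_words N n m \<and> permute_list (s \<circ> t) w = w}"
    from *[OF this s t] show "permute_list t (permute_list s w) = w"
      "permute_list s w \<in> {w. w \<in> bideg_words N n m \<and> permute_list (t \<circ> s) w = w}"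
      "place_sign (permute_list s w) (t \<circ> s) * prod_list (map (\<lambda>a. x (snd a)) (permute_list s w)) =
      place_sign w (s \<circ> t) * prod_list (map (\<lambda>a. x (snd a)) w)" by auto }
  { assume "w \<in> {w. w \<in> bideg_words N n m \<and> permute_list (t \<circ> s) w = w}"
    from *[OF this t s] show "permute_list s (permute_list t w) = w"
      "permute_list t w \<in> {w. w \<in> bideg_words N n m \<and> permute_list (s \<circ> t) w = w}" by auto }
qed

text \<open>A word in the letters \<open>(p, i)\<close> is a pair of a subset of positions (those of the odd letters)
  and a word in the indices \<open>i\<close>, and it is fixed by a permutation iff both components are.\<close>

lemma sum_fixed_bideg_words:
  assumes s: "s permutes {..<n + m}"
  shows "(\<Sum>w | w \<in> bideg_words N n m \<and> permute_list s w = w. prod_list (map (\<lambda>a. x (snd a)) w)) =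
    chi_cyc (n + m) m s * fixed_words_sum N (n + m) x s"
proof -
  define d where "d = n + m"
  let ?A = "{A. A \<subseteq> {0..<d} \<and> card A = m \<and> s ` A = A}"
  let ?U = "{u. set u \<subseteq> {..<N} \<and> length u = d \<and> permute_list s u = u}"
  let ?W = "{w. w \<in> bideg_words N n m \<and> permute_list s w = w}"
  let ?w = "\<lambda>(A, u). map (\<lambda>i. (i \<in> A, u ! i)) [0..<d]"
  have s: "s permutes {..<d}" using s by (simp add: d_def)
  have sd: "s i < d \<longleftrightarrow> i < d" for i using permutes_in_image[OF s, of i] by simp
  have fixed: "permute_list s v = v \<longleftrightarrow> (\<forall>i<d. v ! s i = v ! i)" if "length v = d" for v :: "'b list"
    using that s by (auto simp: list_eq_iff_nth_eq permute_list_nth)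
  have image: "s ` A = A \<longleftrightarrow> (\<forall>i<d. s i \<in> A \<longleftrightarrow> i \<in> A)" if "A \<subseteq> {0..<d}" for A
  proof
    assume "s ` A = A"
    then show "\<forall>i<d. s i \<in> A \<longleftrightarrow> i \<in> A" using inj_image_mem_iff[OF permutes_inj[OF s]] by metis
  next
    assume *: "\<forall>i<d. s i \<in> A \<longleftrightarrow> i \<in> A"
    then have "s ` A \<subseteq> A" using that by auto
    moreover have "finite A" using that finite_subset by blast
    ultimately show "s ` A = A" using permutes_inj_on[OF s] by (simp add: endo_inj_surj)
  qed
  have "(\<Sum>w\<in>?W. prod_list (map (\<lambda>a. x (snd a)) w)) = (\<Sum>(A, u)\<in>?A \<times> ?U. prod_list (map x u))"
  proof (rule sum.reindex_bij_witness[where i = ?w and j = "\<lambda>w. ({i. i < d \<and> fst (w ! i)}, map snd w)"])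
    fix w assume "w \<in> ?W"
    then have w: "w \<in> bideg_words N n m" "permute_list s w = w" by auto
    have l: "length w = d" using length_bideg_words[OF w(1)] by (simp add: d_def)
    show "?w ({i. i < d \<and> fst (w ! i)}, map snd w) = w"
      using l by (intro nth_equalityI) auto
    have f: "w ! s i = w ! i" if "i < d" for i using w(2) fixed[OF l] that by blast
    have "card {i. i < d \<and> fst (w ! i)} = m"
      using w(1) l by (simp add: bideg_words_def length_filter_conv_card)
    moreover have "s ` {i. i < d \<and> fst (w ! i)} = {i. i < d \<and> fst (w ! i)}"
      by (subst image) (auto simp: sd f)
    moreover have "permute_list s (map snd w) = map snd w"
      using fixed[of "map snd w"] l f sd by simp
    ultimately show "({i. i < d \<and> fst (w ! i)}, map snd w) \<in> ?A \<times> ?U"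
      using w(1) l by (auto simp: bideg_words_def)
    show "(case ({i. i < d \<and> fst (w ! i)}, map snd w) of (A, u) \<Rightarrow> prod_list (map x u)) = prod_list (map (\<lambda>a. x (snd a)) w)"
      by (simp add: o_def)
  next
    fix p assume "p \<in> ?A \<times> ?U"
    then obtain A u where p: "p = (A, u)" and A: "A \<subseteq> {0..<d}" "card A = m" "s ` A = A"
      and u: "set u \<subseteq> {..<N}" "length u = d" "permute_list s u = u" by blast
    have uN: "u ! i < N" if "i < d" for i using u(1,2) that by (auto simp: subset_iff)
    have cA: "{i. i < d \<and> i \<in> A} = A" using A(1) by auto
    have "length (filter fst (?w p)) = m"
      using A(2) cA by (simp add: p length_filter_conv_card)
       (metis (no_types, lifting) Collect_cong add_0 nth_map nth_upt fst_conv length_upt diff_zero)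
    moreover from this have "length (filter (\<lambda>a. \<not> fst a) (?w p)) = n"
      using sum_length_filter_compl[of fst "?w p"] by (simp add: p d_def)
    moreover have "permute_list s (?w p) = ?w p"
      by (subst fixed) (use A image[OF A(1)] u fixed[OF u(2)] sd in \<open>auto simp: p\<close>)
    ultimately show "?w p \<in> ?W" using uN by (auto simp: bideg_words_def p)
    show "({i. i < d \<and> fst (?w p ! i)}, map snd (?w p)) = p"
      using A(1) u(2) by (auto simp: p intro!: nth_equalityI)
  qed
  also have "\<dots> = of_nat (card ?A) * (\<Sum>u\<in>?U. prod_list (map x u))"
    by (simp flip: sum.cartesian_product)
  finally show ?thesis by (simp add: chi_cyc_def fixed_words_sum_def d_def)
qed

text \<open>On words fixed by a power of the rotation the sign depends only on the power and the
  bidegree, so it leaves the sum.\<close>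

lemma signed_fixed_sum_rot_pow:
  assumes "n + m > 0"
  shows "signed_fixed_sum N n m x (rot (n + m) ^^ k) =
    (if odd m then 1 else cis (2 * pi / real (n + m)) ^ (m div 2 * k)) *
      (chi_cyc (n + m) m (rot (n + m) ^^ k) * fixed_words_sum N (n + m) x (rot (n + m) ^^ k))"
proof -
  let ?c = "rot (n + m) ^^ k"
  have "signed_fixed_sum N n m x ?c = (\<Sum>w | w \<in> bideg_words N n m \<and> permute_list ?c w = w.
     (if odd m then 1 else cis (2 * pi / real (n + m)) ^ (m div 2 * k)) * prod_list (map (\<lambda>a. x (snd a)) w))"
    unfolding signed_fixed_sum_def
  proof (intro sum.cong refl)
    fix w assume "w \<in> {w. w \<in> bideg_words N n m \<and> permute_list ?c w = w}"
    then have w: "w \<in> bideg_words N n m" "permute_list ?c w = w" by auto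
    have "odd_len w = m" using w(1) by (simp add: bideg_words_def odd_len_def)
    then show "place_sign w ?c * prod_list (map (\<lambda>a. x (snd a)) w) =
       (if odd m then 1 else cis (2 * pi / real (n + m)) ^ (m div 2 * k)) * prod_list (map (\<lambda>a. x (snd a)) w)"
      using place_sign_fixed_rot_pow[OF length_bideg_words[OF w(1)] assms w(2)] by simp
  qed
  then show ?thesis
    unfolding sum_distrib_left[symmetric] sum_fixed_bideg_words[OF rot_pow_permutes] .
qed

section \<open>The cyclic group, its characters and the final formula\<close>

lemma cyc_group_eq: "cyc_group d = (\<lambda>k. rot d ^^ k) ` {..<d}"
  by (auto simp: cyc_group_def)

lemma chi_lin_rot_pow:
  assumes "k < d"
  shows "chi_lin d r (rot d ^^ k) = cis (2 * pi / real d) ^ (r * k)"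
proof -
  have "cyc_exp d (rot d ^^ k) = k"
    unfolding cyc_exp_def
    by (rule the_equality) (use assms inj_onD[OF rot_pow_inj] in auto)
  then have "chi_lin d r (rot d ^^ k) = cis (real (r * k) * (2 * pi / real d))"
    unfolding cis_conv_exp by (simp add: chi_lin_def field_simps)
  then show ?thesis by (simp only: DeMoivre)
qed

lemma primitive_root_cis:
  assumes "d > 0"
  shows "primitive_root d (cis (2 * pi / real d))"
proof
  show "cis (2 * pi / real d) ^ d = 1" using assms by (simp add: DeMoivre)
  fix k :: nat assume k: "0 < k" "k < d"
  show "cis (2 * pi / real d) ^ k \<noteq> 1"
  proof
    assume "cis (2 * pi / real d) ^ k = 1"
    then have "cis (2 * pi * real k / real d) = cis (2 * pi * real 0 / real d)"
      by (simp add: DeMoivre mult.commute)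
    then have "k = 0"
      using k by (intro inj_onD[OF bij_betw_imp_inj_on[OF bij_betw_roots_unity[OF assms]]]) auto
    then show False using k by simp
  qed
qed (use assms in simp)

theorem theorem1p3:
  fixes n m N :: nat and x :: "nat \<Rightarrow> complex"
  assumes "n + m > 0"
    and "\<forall>i<N. x i \<noteq> 0"
  shows "lie_char N n m x =
    frob (n + m)
      (induce_cyc (n + m)
         (\<lambda>c. chi_cyc (n + m) m c *
              chi_lin (n + m) (if odd m then 1 else m div 2 + 1) c))
      N x"
proof -
  define d where "d = n + m"
  define q where "q = cis (2 * pi / real d)"
  let ?r = "if odd m then 1 else m div 2 + 1"
  have d: "d > 0" using assms(1) by (simp add: d_def)
  interpret primitive_root d q unfolding q_def by (rule primitive_root_cis[OF d])
  have "lie_char N n m x = (1 / of_nat d) *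
      (\<Sum>s | s permutes {..<d}. desc_weight q (map (inv s) [0..<d]) * signed_fixed_sum N n m x s)"
    unfolding signed_fixed_sum_def by (rule lie_char_eq_sum_permutations) (simp add: d_def)
  \<comment> \<open>The signed trace is a class function, which reduces the sum to the
    rotations.\<close>
  also have "\<dots> = (1 / of_nat d) * (\<Sum>k<d. q ^ k * signed_fixed_sum N n m x (rot d ^^ k))"
    by (subst sum_maj_weight_class_function) (simp_all add: signed_fixed_sum_commute d_def)
  also have "\<dots> = (1 / of_nat d) * (\<Sum>k<d. chi_cyc d m (rot d ^^ k) * chi_lin d ?r (rot d ^^ k) * fixed_words_sum N d x (rot d ^^ k))"
  proof -
    \<comment> \<open>For even \<open>m\<close> the factor \<open>q ^ k\<close> joins the sign
      \<open>q ^ (m div 2 * k)\<close>; hence the character exponent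
      \<open>m div 2 + 1\<close>.\<close>
    have "q ^ k * signed_fixed_sum N n m x (rot d ^^ k) =
        chi_cyc d m (rot d ^^ k) * chi_lin d ?r (rot d ^^ k) * fixed_words_sum N d x (rot d ^^ k)" if "k < d" for k
      using signed_fixed_sum_rot_pow[OF assms(1), of N x k] chi_lin_rot_pow[OF that, of ?r]
      by (simp add: q_def power_add flip: d_def)
    then show ?thesis by simp
  qed
  also have "\<dots> = (1 / of_nat (card (cyc_group d))) *
      (\<Sum>c\<in>cyc_group d. chi_cyc d m c * chi_lin d ?r c * fixed_words_sum N d x c)"
    unfolding cyc_group_eq by (simp add: card_image sum.reindex rot_pow_inj)
  also have "\<dots> = frob d (induce_cyc d (\<lambda>c. chi_cyc d m c * chi_lin d ?r c)) N x"
    by (rule frob_induce_cyc[symmetric]) (auto simp: cyc_group_eq rot_pow_permutes)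
  finally show ?thesis unfolding d_def .
qed

end
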